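(* Let $\phi:\mathbb{R}^n\to\mathbb{R}$ be continuously differentiable, let $A\in\mathbb{R}^{m\times n}$ have full row rank, let $b\in\mathbb{R}^m$, let $\mathcal{C}_{A,b}=\{x\in\mathbb{R}^n_+ : Ax=b\}\neq\emptyset$, $\mathcal{P}_{A,b}=\{y\in\mathbb{R}^n : A(y\circ y)=b\}$ and $f(y)=\phi(y\circ y)$. Let $\delta,\sigma,\epsilon\in(0,1)$ and $y_0\in\mathcal{P}_{A,b}$. Suppose $\{y_k\}_{k\in\mathbb{N}^+}$ is the sequence generated by Algorithm 1 (described in the context) and $x_k=y_k\circ y_k$. Then for any accumulation point $y^*$ of $\{y_k\}_{k\in\mathbb{N}^+}$, the point $x^*:=y^*\circ y^*$ is a first-order stationary point of $\min\{\phi(x): Ax=b,\ x\in\mathbb{R}^n_+\}$.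
   Context: $\circ$ is the entrywise product, $D_y=\mathrm{Diag}(y)$, $\mathrm{Proj}_{\mathcal{C}}$ is Euclidean projection, and $\sqrt{\cdot}$ is taken entrywise. First-order stationary point of $\min\{\phi(x): Ax=b,\ x\in\mathbb{R}^n_+\}$: $x$ for which there is $\lambda\in\mathbb{R}^m$ with $Ax=b$, $x\ge0$, $\nabla\phi(x)-A^\top\lambda\in\mathbb{R}^n_+$, $(\nabla\phi(x)-A^\top\lambda)\circ x=0$. Strata: for $y\in\mathcal{P}_{A,b}$ let $\mathcal{M}(y)=\{z\in\mathcal{P}_{A,b} : \mathrm{Range}[AD_z]=\mathrm{Range}[AD_y]\}$. There are finitely many distinct such sets, they partition $\mathcal{P}_{A,b}$, and each is an embedded Riemannian submanifold of $\mathbb{R}^n$ with the Euclidean metric. On each stratum $\mathcal{M}$ a retraction is fixed: a smooth map $\mathrm{Retr}:\mathrm{T}\mathcal{M}\to\mathcal{M}$ on the tangent bundle with $\mathrm{Retr}(z,0)=z$ and $\mathrm{D}\,\mathrm{Retr}(z,0)[h]=h$ for all $z\in\mathcal{M}$, $h\in\mathrm{T}_z\mathcal{M}$ (differential of $\mathrm{Retr}(z,\cdot)$ at $0$). The Riemannian gradient is $\mathrm{grad} f(y)=\mathrm{Proj}_{\mathrm{T}_y\mathcal{M}(y)}(\nabla f(y))=\mathrm{Proj}_{\mathrm{Ker}[AD_y]}(2\nabla\phi(y\circ y)\circ y)$. $\sigma$-regularity: for $y\in\mathcal{P}_{A,b}$, $x=y\circ y$, let $AD_xA^\top=L\,\mathrm{Diag}(d)L^\top$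 be an LDL decomposition ($L$ lower triangular with unit diagonal, $d\in\mathbb{R}^m_+$; the vector $d$ is unique). $y$ is $\sigma$-singular if the smallest nonzero entry of $d$ is $<\sigma$; otherwise $y$ is $\sigma$-regular. For $t>0$, $x\in\mathcal{C}_{A,b}$: $h_t(x)=\|\mathrm{Proj}_{\mathcal{C}_{A,b}}(x-t\nabla\phi(x))-x\|/t$. Algorithm 1. Start from $y_0\in\mathcal{P}_{A,b}$, $x_0=y_0\circ y_0$. For $k=0,1,2,\dots$: (a) If $y_k$ is $\sigma$-regular and $\|\mathrm{grad} f(y_k)\|>\epsilon$: set $y_{k+1}=\mathrm{Retr}(y_k,-t_k\,\mathrm{grad} f(y_k))$ and $x_{k+1}=y_{k+1}\circ y_{k+1}$, where $t_k=(1/2)^j$ and $j$ is the smallest $j\in\mathbb{N}=\{0,1,2,\dots\}$ with $f(\mathrm{Retr}(y_k,-(1/2)^j\mathrm{grad} f(y_k)))\le f(y_k)-(1/2)^j\delta\|\mathrm{grad} f(y_k)\|^2$. (b) Otherwise ($y_k$ is $\sigma$-singular or $\|\mathrm{grad} f(y_k)\|\le\epsilon$): set $x_{k+1}=\mathrm{Proj}_{\mathcal{C}_{A,b}}(x_k-t_k\nabla\phi(x_k))$ and $y_{k+1}=\sqrt{x_{k+1}}$, where $t_k=(1/2)^j$ and $j$ is the smallest $j\in\mathbb{N}^+=\{1,2,\dots\}$ with $\phi(\mathrm{Proj}_{\mathcal{C}_{A,b}}(x_k-(1/2)^j\nabla\phi(x_k)))\le\phi(x_k)-(1/2)^j\delta\,h_{(1/2)^j}(x_k)^2$.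 *)

theory Defs
  imports "HOL-Analysis.Analysis"
begin

text \<open>
  On \<open>real ^ 'n\<close> the library product \<open>x * y\<close> and the order \<open>x \<le> y\<close> are entrywise; \<open>y * y\<close> is the
  square in the Hadamard sense. \<open>closest_point C x\<close> is the Euclidean projection onto a nonempty
  closed convex set \<open>C\<close>.
\<close>

definition Diag :: "real ^ 'n \<Rightarrow> real ^ 'n ^ 'n" where
  "Diag v = (\<chi> i j. if i = j then v $ i else 0)"

definition vec_sqrt :: "real ^ 'n \<Rightarrow> real ^ 'n" where
  "vec_sqrt x = (\<chi> i. sqrt (x $ i))"

definition gradient :: "('a::real_inner \<Rightarrow> real) \<Rightarrow> 'a \<Rightarrow> 'a" where
  "gradient f x = (THE g. GDERIV f x :> g)"

definition continuously_differentiable :: "('a::real_inner \<Rightarrow> real) \<Rightarrow> bool" where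
  "continuously_differentiable f \<longleftrightarrow>
     (\<forall>x. f differentiable (at x)) \<and> continuous_on UNIV (gradient f)"

definition accumulation_point :: "(nat \<Rightarrow> 'a::topological_space) \<Rightarrow> 'a \<Rightarrow> bool" where
  "accumulation_point u l \<longleftrightarrow> (\<exists>r. strict_mono r \<and> (u \<circ> r) \<longlonglongrightarrow> l)"


text \<open>\<open>Ck k U f\<close>: \<open>f\<close> is k times continuously differentiable. Only meant for open \<open>U\<close> and
  finite-dimensional domains, where iterated directional derivatives suffice.\<close>

fun Ck :: "nat \<Rightarrow> 'a::euclidean_space set \<Rightarrow> ('a \<Rightarrow> 'b::real_normed_vector) \<Rightarrow> bool" where
  "Ck 0 U f \<longleftrightarrow> continuous_on U f"
| "Ck (Suc k) U f \<longleftrightarrow>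
     (\<forall>x\<in>U. f differentiable (at x)) \<and> (\<forall>v. Ck k U (\<lambda>x. frechet_derivative f (at x) v))"

text \<open>Smoothness of a map on an arbitrary subset (here: an embedded submanifold or its tangent
  bundle) is the existence of local smooth extensions to the ambient space.\<close>

definition smooth_map_on :: "'a::euclidean_space set \<Rightarrow> ('a \<Rightarrow> 'b::real_normed_vector) \<Rightarrow> bool" where
  "smooth_map_on S f \<longleftrightarrow>
     (\<forall>p\<in>S. \<exists>U F. open U \<and> p \<in> U \<and> (\<forall>k. Ck k U F) \<and> (\<forall>q\<in>S \<inter> U. F q = f q))"

text \<open>Tangent space of an embedded submanifold: the velocities of the smooth curves in it.\<close>

definition tangent_space :: "'a::euclidean_space set \<Rightarrow> 'a \<Rightarrow> 'a set" where
  "tangent_space M z = {v. \<exists>c e. e > 0 \<and> smooth_map_on {-e<..<e::real} c \<and>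
     c ` {-e<..<e} \<subseteq> M \<and> c 0 = z \<and> (c has_vector_derivative v) (at 0)}"

definition tangent_bundle :: "'a::euclidean_space set \<Rightarrow> ('a \<times> 'a) set" where
  "tangent_bundle M = {(z, h). z \<in> M \<and> h \<in> tangent_space M z}"

definition manifold_retraction :: "'a::euclidean_space set \<Rightarrow> ('a \<times> 'a \<Rightarrow> 'a) \<Rightarrow> bool" where
  "manifold_retraction M R \<longleftrightarrow>
     smooth_map_on (tangent_bundle M) R \<and>
     R ` tangent_bundle M \<subseteq> M \<and>
     (\<forall>z\<in>M. R (z, 0) = z \<and>
       ((\<lambda>h. R (z, h)) has_derivative (\<lambda>h. h)) (at 0 within tangent_space M z))"


definition feasible_set :: "real ^ 'n ^ 'm \<Rightarrow> real ^ 'm \<Rightarrow> (real ^ 'n) set" where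
  "feasible_set A b = {x. 0 \<le> x \<and> A *v x = b}"

definition lifted_set :: "real ^ 'n ^ 'm \<Rightarrow> real ^ 'm \<Rightarrow> (real ^ 'n) set" where
  "lifted_set A b = {y. A *v (y * y) = b}"

definition lifted_objective :: "(real ^ 'n \<Rightarrow> real) \<Rightarrow> real ^ 'n \<Rightarrow> real" where
  "lifted_objective \<phi> y = \<phi> (y * y)"

definition stratum :: "real ^ 'n ^ 'm \<Rightarrow> real ^ 'm \<Rightarrow> real ^ 'n \<Rightarrow> (real ^ 'n) set" where
  "stratum A b y =
     {z \<in> lifted_set A b. range ((*v) (A ** Diag z)) = range ((*v) (A ** Diag y))}"

text \<open>The tangent space of a stratum at \<open>y\<close> may be strictly smaller than the kernel of
  \<open>A ** Diag y\<close> (a zero entry of \<open>y\<close> stays zero on the stratum if its column of \<open>A\<close> is not in the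
  range), but \<open>gradient (lifted_objective \<phi>) y\<close> has the same projection onto both.\<close>

definition riemannian_grad ::
  "(real ^ 'n \<Rightarrow> real) \<Rightarrow> real ^ 'n ^ 'm \<Rightarrow> real ^ 'm \<Rightarrow> real ^ 'n \<Rightarrow> real ^ 'n" where
  "riemannian_grad \<phi> A b y =
     closest_point (tangent_space (stratum A b y) y) (gradient (lifted_objective \<phi>) y)"

definition first_order_stationary ::
  "(real ^ 'n \<Rightarrow> real) \<Rightarrow> real ^ 'n ^ 'm \<Rightarrow> real ^ 'm \<Rightarrow> real ^ 'n \<Rightarrow> bool" where
  "first_order_stationary \<phi> A b x \<longleftrightarrow>
     (\<exists>\<mu>. A *v x = b \<and> 0 \<le> x \<and>
        0 \<le> gradient \<phi> x - transpose A *v \<mu> \<and>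
        (gradient \<phi> x - transpose A *v \<mu>) * x = 0)"

definition is_ldl ::
  "real ^ ('m::{finite,linorder}) ^ ('m::{finite,linorder}) \<Rightarrow> real ^ ('m::{finite,linorder}) ^ ('m::{finite,linorder}) \<Rightarrow> real ^ ('m::{finite,linorder}) \<Rightarrow> bool" where
  "is_ldl S L d \<longleftrightarrow>
     (\<forall>i j. i < j \<longrightarrow> L $ i $ j = 0) \<and> (\<forall>i. L $ i $ i = 1) \<and> 0 \<le> d \<and>
     S = L ** Diag d ** transpose L"

text \<open>If \<open>d = 0\<close> there is no nonzero entry and the point counts as regular.\<close>

definition sigma_singular ::
  "real \<Rightarrow> real ^ 'n ^ ('m::{finite,linorder}) \<Rightarrow> real ^ 'n \<Rightarrow> bool" where
  "sigma_singular \<sigma> A y \<longleftrightarrow>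
     (\<exists>L d. is_ldl (A ** Diag (y * y) ** transpose A) L d \<and>
        (let N = {d $ i | i. d $ i \<noteq> 0} in N \<noteq> {} \<and> Min N < \<sigma>))"

definition proj_step ::
  "(real ^ 'n \<Rightarrow> real) \<Rightarrow> real ^ 'n ^ 'm \<Rightarrow> real ^ 'm \<Rightarrow> real \<Rightarrow> real ^ 'n \<Rightarrow> real ^ 'n" where
  "proj_step \<phi> A b t x = closest_point (feasible_set A b) (x - t *\<^sub>R gradient \<phi> x)"

definition proj_residual ::
  "(real ^ 'n \<Rightarrow> real) \<Rightarrow> real ^ 'n ^ 'm \<Rightarrow> real ^ 'm \<Rightarrow> real \<Rightarrow> real ^ 'n \<Rightarrow> real" where
  "proj_residual \<phi> A b t x = norm (proj_step \<phi> A b t x - x) / t"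

definition retr_step ::
  "((real ^ 'n) set \<Rightarrow> (real ^ 'n) \<times> (real ^ 'n) \<Rightarrow> real ^ 'n) \<Rightarrow> (real ^ 'n \<Rightarrow> real) \<Rightarrow>
   real ^ 'n ^ 'm \<Rightarrow> real ^ 'm \<Rightarrow> real \<Rightarrow> real ^ 'n \<Rightarrow> real ^ 'n" where
  "retr_step Retr \<phi> A b t y = Retr (stratum A b y) (y, - t *\<^sub>R riemannian_grad \<phi> A b y)"

definition retr_stepsize ::
  "((real ^ 'n) set \<Rightarrow> (real ^ 'n) \<times> (real ^ 'n) \<Rightarrow> real ^ 'n) \<Rightarrow> (real ^ 'n \<Rightarrow> real) \<Rightarrow>
   real ^ 'n ^ 'm \<Rightarrow> real ^ 'm \<Rightarrow> real \<Rightarrow> real ^ 'n \<Rightarrow> real" where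
  "retr_stepsize Retr \<phi> A b \<delta> y =
     (1/2) ^ (LEAST j. lifted_objective \<phi> (retr_step Retr \<phi> A b ((1/2) ^ j) y)
        \<le> lifted_objective \<phi> y - (1/2) ^ j * \<delta> * (norm (riemannian_grad \<phi> A b y))\<^sup>2)"

definition proj_stepsize ::
  "(real ^ 'n \<Rightarrow> real) \<Rightarrow> real ^ 'n ^ 'm \<Rightarrow> real ^ 'm \<Rightarrow> real \<Rightarrow> real ^ 'n \<Rightarrow> real" where
  "proj_stepsize \<phi> A b \<delta> x =
     (1/2) ^ (LEAST j. 1 \<le> j \<and> \<phi> (proj_step \<phi> A b ((1/2) ^ j) x)
        \<le> \<phi> x - (1/2) ^ j * \<delta> * (proj_residual \<phi> A b ((1/2) ^ j) x)\<^sup>2)"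

text \<open>\<open>Retr M\<close> is the retraction fixed on the stratum \<open>M\<close>.\<close>

definition hybrid_run ::
  "(real ^ 'n \<Rightarrow> real) \<Rightarrow> real ^ 'n ^ ('m::{finite,linorder}) \<Rightarrow> real ^ ('m::{finite,linorder}) \<Rightarrow>
   ((real ^ 'n) set \<Rightarrow> (real ^ 'n) \<times> (real ^ 'n) \<Rightarrow> real ^ 'n) \<Rightarrow>
   real \<Rightarrow> real \<Rightarrow> real \<Rightarrow> (nat \<Rightarrow> real ^ 'n) \<Rightarrow> (nat \<Rightarrow> real ^ 'n) \<Rightarrow> bool" where
  "hybrid_run \<phi> A b Retr \<delta> \<sigma> \<epsilon> x y \<longleftrightarrow>
     x 0 = y 0 * y 0 \<and>
     (\<forall>k. if \<not> sigma_singular \<sigma> A (y k) \<and> norm (riemannian_grad \<phi> A b (y k)) > \<epsilon>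
          then y (Suc k) = retr_step Retr \<phi> A b (retr_stepsize Retr \<phi> A b \<delta> (y k)) (y k) \<and>
               x (Suc k) = y (Suc k) * y (Suc k)
          else x (Suc k) = proj_step \<phi> A b (proj_stepsize \<phi> A b \<delta> (x k)) (x k) \<and>
               y (Suc k) = vec_sqrt (x (Suc k)))"

end

theory Submission
  imports Defs
begin

text \<open>
  The values \<open>\<phi>(x\<^sub>k)\<close> are nonincreasing and bounded below by \<open>\<phi>(x\<^sup>*)\<close>, so along the subsequence
  converging to \<open>y\<^sup>*\<close> no fixed positive decrease can occur infinitely often. If infinitely many of these
  steps were Riemannian, then, since the pivots of regular points are at least \<open>\<sigma>\<close>, \<open>y\<^sup>*\<close> would lie on the
  stratum of infinitely many of them; near \<open>y\<^sup>*\<close> on that stratum the backtracking step sizes are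
  bounded below, and each step decreases \<open>f\<close> by a fixed multiple of \<open>\<epsilon>\<^sup>2\<close>, a contradiction. Hence
  infinitely many steps are projected gradient steps. If \<open>x\<^sup>*\<close> were not a fixed point of the
  projected gradient map, these would decrease \<open>\<phi>\<close> by a fixed amount near \<open>x\<^sup>*\<close>; so \<open>x\<^sup>*\<close> is a fixed point,
  and the multipliers come from a separation argument.
\<close>

section \<open>Gradients, ranges and the tangent spaces of strata\<close>

text \<open>A retraction is smooth only inside its own stratum, with no uniformity between strata,
  so a lower bound on Armijo steps can be drawn only from a limit point on that same stratum. The
  danger is loss of rank: \<open>A ** Diag y\<close> may degenerate as entries of \<open>y\<close>
  tend to 0. The pivot of row \<open>k\<close> is the squared distance of that row of
  \<open>A ** Diag y\<close> from the span of the earlier rows, so a lower bound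
  \<open>\<sigma>\<close> on the nonzero pivots keeps independent rows quantitatively independent,
  and the range survives the limit. Projected steps meet no such obstacle: the projection onto the
  fixed convex set is continuous, and the residual for \<open>t \<le> 1\<close> is at least that of
  the unit step. Both step size bounds rest on continuity of derivatives, the mean value theorem and
  the slack \<open>1 - \<delta>\<close> in the Armijo test. The threshold \<open>\<epsilon>\<close>
  keeps the Riemannian gradients away from 0 and so turns a step size bound into a fixed
  decrease.\<close>

lemma GDERIV_unique:
  assumes "GDERIV f x :> g" "GDERIV f x :> g'"
  shows "g = g'"
proof -
  have "(\<lambda>h. inner h g) = (\<lambda>h. inner h g')"
    using assms unfolding gderiv_def by (rule has_derivative_unique)
  then have "\<forall>h. inner h g = inner h g'" by meson
  then show ?thesis by (simp only: vector_eq_ldot)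
qed

lemma gradient_eqI:
  assumes "GDERIV f x :> g"
  shows "gradient f x = g"
  unfolding gradient_def using assms by (blast intro: the_equality GDERIV_unique)

lemma GDERIV_gradient:
  fixes f :: "'a::euclidean_space \<Rightarrow> real"
  assumes "f differentiable (at x)"
  shows "GDERIV f x :> gradient f x"
proof -
  obtain f' where f': "(f has_derivative f') (at x)"
    using assms unfolding differentiable_def by blast
  then have "linear f'" by (rule has_derivative_linear)
  \<comment> \<open>The Riesz vector of a linear functional is its adjoint applied to
    \<open>1\<close>.\<close>
  have "f' = (\<lambda>h. inner h (adjoint f' 1))"
    using adjoint_works[OF \<open>linear f'\<close>, of _ 1] by simp
  with f' have "GDERIV f x :> adjoint f' 1"
    unfolding gderiv_def by metis
  then show ?thesis by (simp only: gradient_eqI)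
qed

lemma inner_mult_vec: "inner (u * v) w = inner u (v * (w :: real ^ 'n))"
  by (simp add: inner_vec_def mult_ac)

lemma bounded_bilinear_times_vec:
  "bounded_bilinear (\<lambda>x y. x * y :: real ^ 'n)"
proof -
  have "bilinear (\<lambda>x y. x * y :: real ^ 'n)"
    by (auto simp: bilinear_def linear_iff algebra_simps vec_eq_iff)
  then show ?thesis by (simp add: bilinear_conv_bounded_bilinear)
qed

lemmas continuous_on_times_vec [continuous_intros] =
  bounded_bilinear.continuous_on[OF bounded_bilinear_times_vec]

lemmas tendsto_times_vec [tendsto_intros] =
  bounded_bilinear.tendsto[OF bounded_bilinear_times_vec]

lemma has_derivative_square_vec:
  assumes "(F has_derivative F') (at x within S)"
  shows "((\<lambda>x. F x * F x :: real ^ 'n) has_derivative (\<lambda>h. 2 *\<^sub>R (F x * F' h))) (at x within S)"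
  using bounded_bilinear.FDERIV[OF bounded_bilinear_times_vec assms assms]
  by (simp add: mult.commute scaleR_2)

lemma GDERIV_lifted_objective:
  assumes "continuously_differentiable \<phi>"
  shows "GDERIV (lifted_objective \<phi>) y :> 2 *\<^sub>R (gradient \<phi> (y * y) * y)"
proof -
  have "(\<phi> has_derivative (\<lambda>h. inner h (gradient \<phi> (y * y)))) (at (y * y))"
    using assms GDERIV_gradient unfolding continuously_differentiable_def gderiv_def by blast
  moreover have "((\<lambda>y. y * y) has_derivative (\<lambda>h. 2 *\<^sub>R (y * h))) (at y)"
    by (rule has_derivative_square_vec[OF has_derivative_ident])
  ultimately have "((\<lambda>y. \<phi> (y * y)) has_derivative (\<lambda>h. inner (2 *\<^sub>R (y * h)) (gradient \<phi> (y * y)))) (at y)"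
    by (rule has_derivative_compose[rotated])
  then show ?thesis
    unfolding gderiv_def lifted_objective_def by (simp add: inner_mult_vec mult.commute)
qed

lemma continuously_differentiable_lifted_objective:
  assumes "continuously_differentiable \<phi>"
  shows "continuously_differentiable (lifted_objective \<phi>)"
  unfolding continuously_differentiable_def
proof
  note G = GDERIV_lifted_objective[OF assms]
  show "\<forall>y. lifted_objective \<phi> differentiable (at y)"
    using G unfolding gderiv_def differentiable_def by blast
  have "continuous_on UNIV (\<lambda>y. gradient \<phi> (y * y))"
    using assms unfolding continuously_differentiable_def
    by (intro continuous_on_compose2[of UNIV "gradient \<phi>" UNIV "\<lambda>y. y * y"] continuous_intros) auto
  then show "continuous_on UNIV (gradient (lifted_objective \<phi>))"
    unfolding gradient_eqI[OF G, abs_def] by (intro continuous_intros)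
qed

section \<open>The range of \<open>A ** Diag y\<close> and the support of \<open>y\<close>\<close>

lemma Diag_mult_vector: "Diag y *v w = y * w"
  by (simp add: vec_eq_iff Diag_def matrix_vector_mult_def if_distrib[where f="\<lambda>x. x * _"] cong: if_cong)

lemma mult_Diag_vector: "(A ** Diag y) *v w = A *v (y * w)"
  by (simp add: matrix_vector_mul_assoc[symmetric] Diag_mult_vector)

lemma subspace_range_matrix: "subspace (range ((*v) (A :: real ^ 'n ^ 'm)))"
  by (simp add: linear_subspace_image)

text \<open>One half of the fact that the range of \<open>A ** Diag y\<close> is the span of the
  columns of \<open>A\<close> on the support of \<open>y\<close>; \<open>range_Diag_subset\<close>
  is the other half. Strata are handled through this description only.\<close>

lemma column_in_range_Diag:
  fixes A :: "real ^ 'n ^ 'm"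
  assumes "y $ j \<noteq> 0"
  shows "column j A \<in> range ((*v) (A ** Diag y))"
proof -
  have "y * axis j (1 / y $ j) = axis j 1"
    using assms by (auto simp: vec_eq_iff axis_def)
  then have "(A ** Diag y) *v axis j (1 / y $ j) = column j A"
    by (simp add: mult_Diag_vector matrix_vector_mult_basis)
  then show ?thesis by (metis rangeI)
qed

lemma mult_in_subspace:
  fixes A :: "real ^ 'n ^ 'm"
  assumes "subspace V" "\<And>j. x $ j \<noteq> 0 \<Longrightarrow> column j A \<in> V"
  shows "A *v x \<in> V"
proof -
  have "x $ j *s column j A \<in> V" for j
    using assms by (cases "x $ j = 0") (auto simp: subspace_0 scalar_mult_eq_scaleR subspace_scale)
  then show ?thesis
    unfolding matrix_mult_sum by (intro subspace_sum[OF assms(1)]) auto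
qed

lemma range_Diag_subset:
  fixes A :: "real ^ 'n ^ 'm"
  assumes "subspace V" "\<And>j. y $ j \<noteq> 0 \<Longrightarrow> column j A \<in> V"
  shows "range ((*v) (A ** Diag y)) \<subseteq> V"
  using assms by (auto simp: mult_Diag_vector intro!: mult_in_subspace)

lemma range_Diag_mono:
  fixes A :: "real ^ 'n ^ 'm"
  assumes "\<And>j. y $ j \<noteq> 0 \<Longrightarrow> z $ j \<noteq> 0"
  shows "range ((*v) (A ** Diag y)) \<subseteq> range ((*v) (A ** Diag z))"
  using assms by (intro range_Diag_subset subspace_range_matrix column_in_range_Diag) auto

section \<open>Smooth curves and the tangent spaces of strata\<close>

lemma has_vector_derivative_vec_lambda:
  fixes f :: "real \<Rightarrow> 'n::finite \<Rightarrow> real"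
  assumes "\<And>j. ((\<lambda>t. f t j) has_real_derivative D j) (at x)"
  shows "((\<lambda>t. \<chi> j. f t j) has_vector_derivative (\<chi> j. D j)) (at x)"
  unfolding has_vector_derivative_def
proof (subst has_derivative_componentwise_within, safe)
  fix b :: "real ^ 'n" assume "b \<in> Basis"
  then obtain j where "b = axis j 1"
    by (auto simp: Basis_vec_def)
  then show "((\<lambda>t. (\<chi> j. f t j) \<bullet> b) has_derivative (\<lambda>t. (t *\<^sub>R (\<chi> j. D j)) \<bullet> b)) (at x)"
    using assms[of j] by (simp add: inner_axis has_field_derivative_def mult_commute_abs)
qed

text \<open>Openness makes functions that agree on \<open>U\<close> have the same derivatives there.
  This lets a derivative computed by formula replace \<open>frechet_derivative\<close>, whose values
  off \<open>U\<close> are unknown.\<close>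

lemma Ck_cong:
  assumes "open U" "\<And>x. x \<in> U \<Longrightarrow> f x = g x" "Ck k U f"
  shows "Ck k U g"
  using assms(2,3)
proof (induction k arbitrary: f g)
  case 0
  then show ?case by (simp cong: continuous_on_cong)
next
  case (Suc k)
  have f: "(f has_derivative frechet_derivative f (at x)) (at x)" if "x \<in> U" for x
    using Suc.prems(2) that unfolding Ck.simps frechet_derivative_works by blast
  have g: "(g has_derivative frechet_derivative f (at x)) (at x)" if "x \<in> U" for x
    using f[OF that] assms(1) that Suc.prems(1) by (rule has_derivative_transform_within_open)
  have "Ck k U (\<lambda>x. frechet_derivative g (at x) v)" for v
  proof (rule Suc.IH)
    show "frechet_derivative f (at x) v = frechet_derivative g (at x) v" if "x \<in> U" for x
      by (simp only: frechet_derivative_at[OF g[OF that], symmetric])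
    show "Ck k U (\<lambda>x. frechet_derivative f (at x) v)"
      using Suc.prems(2) by simp
  qed
  with g show ?case
    unfolding Ck.simps differentiable_def by blast
qed

text \<open>Products of a polynomial and a power of a positive polynomial are closed under
  differentiation, which gives smoothness of all orders by induction.\<close>

lemma has_vector_derivative_poly_powr:
  fixes p q :: "'n::finite \<Rightarrow> real poly"
  assumes "\<And>j. poly (q j) t > 0"
  shows "((\<lambda>t. \<chi> j. poly (p j) t * poly (q j) t powr a j) has_vector_derivative
    (\<chi> j. poly (pderiv (p j) * q j + smult (a j) (p j * pderiv (q j))) t * poly (q j) t powr (a j - 1))) (at t)"
proof (rule has_vector_derivative_vec_lambda)
  fix j
  have eq: "poly (q j) t powr a j = poly (q j) t * poly (q j) t powr (a j - 1)"
    using assms[of j] by (simp add: powr_diff)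
  show "((\<lambda>t. poly (p j) t * poly (q j) t powr a j) has_real_derivative
    poly (pderiv (p j) * q j + smult (a j) (p j * pderiv (q j))) t * poly (q j) t powr (a j - 1)) (at t)"
    by (rule DERIV_cong[OF DERIV_mult[OF poly_DERIV
          DERIV_chain2[OF has_real_derivative_powr[OF assms] poly_DERIV]]], subst eq)
       (simp add: algebra_simps)
qed

lemma Ck_poly_powr:
  fixes p q :: "'n::finite \<Rightarrow> real poly"
  assumes "open U" and pos: "\<And>j t. t \<in> U \<Longrightarrow> poly (q j) t > 0"
  shows "Ck k U (\<lambda>t. \<chi> j. poly (p j) t * poly (q j) t powr a j)"
proof (induction k arbitrary: p a)
  case 0
  have "continuous_on U (\<lambda>t. poly (p j) t * poly (q j) t powr a j)" for j
    by (intro continuous_intros ballI) (metis pos less_irrefl)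
  then show ?case by (auto intro: continuous_on_vec_lambda)
next
  case (Suc k)
  let ?F = "\<lambda>t. \<chi> j. poly (p j) t * poly (q j) t powr a j"
  let ?p = "\<lambda>j. pderiv (p j) * q j + smult (a j) (p j * pderiv (q j))"
  have D: "(?F has_derivative (\<lambda>v. v *\<^sub>R (\<chi> j. poly (?p j) t * poly (q j) t powr (a j - 1)))) (at t)"
    if "t \<in> U" for t
    using has_vector_derivative_poly_powr[of q t p a] pos that by (simp add: has_vector_derivative_def)
  have "Ck k U (\<lambda>t. frechet_derivative ?F (at t) v)" for v
  proof (rule Ck_cong[OF \<open>open U\<close> _ Suc.IH[of "\<lambda>j. smult v (?p j)" "\<lambda>j. a j - 1"]])
    fix t assume "t \<in> U"
    from frechet_derivative_at[OF D[OF this], symmetric]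
    show "(\<chi> j. poly (smult v (?p j)) t * poly (q j) t powr (a j - 1)) = frechet_derivative ?F (at t) v"
      by (simp add: vec_eq_iff)
  qed
  with D show ?case by (auto simp: differentiable_def)
qed

text \<open>A linear description of the tangent space. Velocities of curves are not visibly closed
  under addition, whereas projection and the passage to limits need a subspace given by
  equations.\<close>

definition stratum_tangent :: "real ^ 'n ^ 'm \<Rightarrow> real ^ 'n \<Rightarrow> (real ^ 'n) set" where
  "stratum_tangent A z = {h. A *v (z * h) = 0 \<and>
     (\<forall>j. column j A \<notin> range ((*v) (A ** Diag z)) \<longrightarrow> h $ j = 0)}"

lemma subspace_stratum_tangent: "subspace (stratum_tangent A z)"
  by (auto simp: subspace_def stratum_tangent_def distrib_left matrix_vector_right_distrib
      matrix_vector_mult_scaleR)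

text \<open>Along a curve in the stratum \<open>A *v (c t * c t)\<close> is constant, and a
  coordinate whose column lies outside the common range vanishes identically. Differentiating these
  two facts at 0 gives the two conditions.\<close>

lemma tangent_space_stratum_subset:
  "tangent_space (stratum A b z) z \<subseteq> stratum_tangent A z"
proof
  fix h assume "h \<in> tangent_space (stratum A b z) z"
  then obtain c e where e: "e > 0" and sub: "c ` {-e<..<e::real} \<subseteq> stratum A b z"
    and c0: "c 0 = z" and dc: "(c has_vector_derivative h) (at 0)"
    unfolding tangent_space_def by blast
  have "((\<lambda>t. A *v (c t * c t)) has_derivative (\<lambda>t. A *v (2 *\<^sub>R (z * (t *\<^sub>R h))))) (at 0)"
    by (rule bounded_linear.has_derivative[OF matrix_vector_mul_bounded_linear
          has_derivative_square_vec[OF dc[unfolded has_vector_derivative_def], unfolded c0]])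
  moreover have "((\<lambda>t. A *v (c t * c t)) has_derivative (\<lambda>t. 0)) (at 0)"
    by (rule has_derivative_transform_within_open[of "\<lambda>_. b" _ _ _ "{-e<..<e}"])
       (use e sub in \<open>auto simp: stratum_def lifted_set_def image_subset_iff\<close>)
  ultimately have "(\<lambda>t. A *v (2 *\<^sub>R (z * (t *\<^sub>R h)))) = (\<lambda>t. 0)"
    by (rule has_derivative_unique)
  from fun_cong[OF this, of 1] have 1: "A *v (z * h) = 0"
    by (simp add: matrix_vector_mult_scaleR)
  have "h $ j = 0" if "column j A \<notin> range ((*v) (A ** Diag z))" for j
  proof -
    have cj: "0 = c t $ j" if "t \<in> {-e<..<e}" for t
    proof -
      have "c t \<in> stratum A b z"
        using sub that by blast
      then show ?thesis
        using column_in_range_Diag[of "c t" j A] \<open>column j A \<notin> _\<close> unfolding stratum_def by auto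
    qed
    have "((\<lambda>t. c t $ j) has_derivative (\<lambda>t. 0)) (at 0)"
      by (rule has_derivative_transform_within_open[OF has_derivative_const _ _ cj, of "{-e<..<e}"]) (use e in auto)
    moreover have "((\<lambda>t. c t $ j) has_derivative (\<lambda>t. (t *\<^sub>R h) $ j)) (at 0)"
      using dc unfolding has_vector_derivative_def
      by (rule bounded_linear.has_derivative[OF bounded_linear_vec_nth])
    ultimately have "(\<lambda>t. (t *\<^sub>R h) $ j) = (\<lambda>t. 0)"
      by (rule has_derivative_unique[rotated])
    from fun_cong[OF this, of 1] show ?thesis by simp
  qed
  with 1 show "h \<in> stratum_tangent A z" by (simp add: stratum_tangent_def)
qed

text \<open>A tangent vector \<open>h\<close> is the velocity of the curve with \<open>c\<^sub>j(t) = sgn z\<^sub>j \<cdot> sqrt ((z\<^sub>j + t h\<^sub>j)\<^sup>2 - t\<^sup>2 z\<^sub>j w\<^sub>j)\<close>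
  where \<open>z\<^sub>j \<noteq> 0\<close> and \<open>c\<^sub>j(t) = t h\<^sub>j\<close> elsewhere; \<open>w\<close> compensates the second order error: \<open>A (h \<circ> h) = A D\<^sub>z w\<close>.\<close>

lemma stratum_tangent_subset:
  assumes z: "z \<in> lifted_set A b"
  shows "stratum_tangent A z \<subseteq> tangent_space (stratum A b z) z"
proof
  fix h assume h: "h \<in> stratum_tangent A z"
  let ?V = "range ((*v) (A ** Diag z))"
  \<comment> \<open>The second tangency condition enters here: \<open>h * h\<close> is supported on
    columns inside \<open>?V\<close>, so the quadratic error can be cancelled by some
    \<open>w\<close>.\<close>
  have "A *v (h * h) \<in> ?V"
    using h by (intro mult_in_subspace subspace_range_matrix) (auto simp: stratum_tangent_def)
  then obtain w where w: "A *v (z * w) = A *v (h * h)"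
    by (auto simp: mult_Diag_vector)
  \<comment> \<open>Both cases get the shape that \<open>Ck_poly_powr\<close> covers, with
    \<open>q j\<close> positive near 0; where \<open>z $ j = 0\<close> the root is trivial because
    \<open>q j = 1\<close>.\<close>
  define p where "p j = (if z $ j = 0 then [:0, h $ j:] else [:sgn (z $ j):])" for j
  define q where "q j = (if z $ j = 0 then 1 else [:z $ j, h $ j:]^2 - [:0, 0, z $ j * w $ j:])" for j
  define c :: "real \<Rightarrow> real ^ 'a" where "c t = (\<chi> j. poly (p j) t * poly (q j) t powr (1/2))" for t
  have "eventually (\<lambda>t. \<forall>j. poly (q j) t > 0) (nhds 0)"
  proof (rule eventually_all_finite)
    fix j
    have "poly (q j) 0 > 0" by (auto simp: q_def)
    moreover have "isCont (poly (q j)) 0" by simp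
    ultimately show "eventually (\<lambda>t. poly (q j) t > 0) (nhds 0)"
      by (metis order_tendstoD(1) isCont_def tendsto_at_iff_tendsto_nhds)
  qed
  then obtain e where e: "e > 0" and q_pos: "\<And>t j. t \<in> {-e<..<e} \<Longrightarrow> poly (q j) t > 0"
    by (auto simp: eventually_nhds_metric dist_real_def abs_less_iff)
  have sq: "c t * c t = z * z + (2 * t) *\<^sub>R (z * h) + t\<^sup>2 *\<^sub>R (h * h) - t\<^sup>2 *\<^sub>R (z * w)"
    if "t \<in> {-e<..<e}" for t
  proof (subst vec_eq_iff, intro allI)
    fix j
    have "poly (q j) t powr (1/2) * poly (q j) t powr (1/2) = poly (q j) t"
      using q_pos[OF that, of j] by (simp add: powr_add[symmetric])
    then have "(c t * c t) $ j = (poly (p j) t)\<^sup>2 * poly (q j) t"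
      by (simp add: c_def power2_eq_square mult_ac)
    also have "\<dots> = (z * z + (2 * t) *\<^sub>R (z * h) + t\<^sup>2 *\<^sub>R (h * h) - t\<^sup>2 *\<^sub>R (z * w)) $ j"
      by (auto simp: p_def q_def sgn_if power2_eq_square algebra_simps)
    finally show "(c t * c t) $ j = (z * z + (2 * t) *\<^sub>R (z * h) + t\<^sup>2 *\<^sub>R (h * h) - t\<^sup>2 *\<^sub>R (z * w)) $ j" .
  qed
  have c_in: "c t \<in> stratum A b z" if t: "t \<in> {-e<..<e}" for t
  proof -
    have "A *v (c t * c t) = b"
      using h z w unfolding sq[OF t]
      by (simp add: stratum_tangent_def lifted_set_def matrix_vector_right_distrib
          matrix_vector_mult_diff_distrib matrix_vector_mult_scaleR)
    moreover have "?V \<subseteq> range ((*v) (A ** Diag (c t)))"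
    proof (rule range_Diag_mono)
      fix j show "z $ j \<noteq> 0 \<Longrightarrow> c t $ j \<noteq> 0"
        using q_pos[OF t, of j] by (auto simp: c_def p_def sgn_if)
    qed
    \<comment> \<open>Zero entries of \<open>z\<close> become nonzero along the curve only where
      \<open>h $ j\<close> is nonzero, and there tangency already puts the column into
      \<open>?V\<close>.\<close>
    moreover have "range ((*v) (A ** Diag (c t))) \<subseteq> ?V"
    proof (rule range_Diag_subset[OF subspace_range_matrix])
      fix j assume "c t $ j \<noteq> 0"
      then have "z $ j \<noteq> 0 \<or> h $ j \<noteq> 0" by (auto simp: c_def p_def split: if_splits)
      then show "column j A \<in> ?V"
        using h column_in_range_Diag by (auto simp: stratum_tangent_def)
    qed
    ultimately show ?thesis by (auto simp: stratum_def lifted_set_def)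
  qed
  have "c 0 = z"
    by (auto simp: vec_eq_iff c_def p_def q_def sgn_if powr_half_sqrt)
  moreover have "(c has_vector_derivative h) (at 0)"
  proof -
    have "poly (pderiv (p j) * q j + smult (1/2) (p j * pderiv (q j))) 0 * poly (q j) 0 powr (1/2 - 1) = h $ j" for j
    proof (cases "z $ j = 0")
      case False
      then have "((z $ j)\<^sup>2) powr (1/2) = \<bar>z $ j\<bar>"
        by (simp add: powr_half_sqrt)
      then have "((z $ j)\<^sup>2) powr (1/2 - 1) = \<bar>z $ j\<bar> / (z $ j)\<^sup>2"
        using False by (subst powr_diff) auto
      then show ?thesis
        using False by (auto simp: p_def q_def pderiv_pCons pderiv_power pderiv_diff
          power2_eq_square sgn_if pderiv_mult)
    qed (simp add: p_def q_def pderiv_pCons)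
    then have "(\<chi> j. poly (pderiv (p j) * q j + smult (1/2) (p j * pderiv (q j))) 0 * poly (q j) 0 powr (1/2 - 1)) = h"
      by (simp add: vec_eq_iff)
    with has_vector_derivative_poly_powr[of q 0 p "\<lambda>_. 1/2"] q_pos[of 0] e show ?thesis
      unfolding c_def by auto
  qed
  moreover have "smooth_map_on {-e<..<e} c"
    unfolding smooth_map_on_def
  proof
    fix t assume t: "t \<in> {-e<..<e}"
    show "\<exists>U F. open U \<and> t \<in> U \<and> (\<forall>k. Ck k U F) \<and> (\<forall>q\<in>{- e<..<e} \<inter> U. F q = c q)"
    proof (intro exI[of _ "{-e<..<e}"] exI[of _ c] conjI allI ballI)
      show "Ck k {-e<..<e} c" for k
        unfolding c_def[abs_def] by (rule Ck_poly_powr[OF _ q_pos]) auto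
    qed (use t in auto)
  qed
  ultimately show "h \<in> tangent_space (stratum A b z) z"
    using e c_in unfolding tangent_space_def by blast
qed

lemma tangent_space_stratum:
  "z \<in> lifted_set A b \<Longrightarrow> tangent_space (stratum A b z) z = stratum_tangent A z"
  using tangent_space_stratum_subset stratum_tangent_subset by blast

section \<open>Projected gradient steps\<close>

lemma inner_transpose_mult: "inner d (transpose A *v u) = inner (A *v d) (u :: real ^ 'm)"
  for A :: "real ^ 'n ^ 'm"
  by (metis dot_lmul_matrix inner_commute transpose_matrix_vector)

lemma closed_feasible_set: "closed (feasible_set A b)"
  for A :: "real ^ 'n ^ 'm"
proof -
  have "feasible_set A b = (\<Inter>j. {x. 0 \<le> x $ j}) \<inter> {x. A *v x = b}"
    by (auto simp: feasible_set_def less_eq_vec_def)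
  also have "closed \<dots>"
    by (intro closed_Int closed_INT ballI closed_Collect_le closed_Collect_eq continuous_intros
        linear_continuous_on matrix_vector_mul_bounded_linear)
  finally show ?thesis .
qed

lemma convex_feasible_set: "convex (feasible_set A b)"
  for A :: "real ^ 'n ^ 'm"
  unfolding convex_def feasible_set_def less_eq_vec_def
  by (auto simp: matrix_vector_right_distrib matrix_vector_mult_scaleR scaleR_add_left[symmetric])

text \<open>The KKT multipliers come from separating \<open>\<nabla>\<phi>(x)\<close> from the finitely generated, hence closed,
  cone spanned by \<open>\<plusminus>\<close> the rows of \<open>A\<close> and the unit vectors of the active coordinates.\<close>

lemma first_order_stationaryI:
  fixes A :: "real ^ 'n ^ 'm"
  assumes x: "x \<in> feasible_set A b"
    and var: "\<And>z. z \<in> feasible_set A b \<Longrightarrow> inner (gradient \<phi> x) (z - x) \<ge> 0"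
  shows "first_order_stationary \<phi> A b x"
proof -
  let ?g = "gradient \<phi> x"
  define G where "G = range (\<lambda>i. transpose A *v axis i 1) \<union> range (\<lambda>i. - (transpose A *v axis i 1))
    \<union> (\<lambda>j. axis j 1) ` {j. x $ j = 0}"
  let ?K = "convex_cone hull G"
  have "?g \<in> ?K"
  proof (rule ccontr)
    assume "?g \<notin> ?K"
    moreover have "closed ?K"
      by (rule closed_convex_cone_hull) (simp add: G_def)
    ultimately obtain d \<beta> where d: "inner d ?g < \<beta>" "\<And>k. k \<in> ?K \<Longrightarrow> \<beta> < inner d k"
      using separating_hyperplane_closed_point[OF convex_convex_cone_hull] by metis
    have "\<beta> < 0"
      using d(2)[OF convex_cone_hull_contains_0] by simp
    have pos: "inner d k \<ge> 0" if "k \<in> G" for k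
    proof (rule ccontr)
      assume neg: "\<not> inner d k \<ge> 0"
      \<comment> \<open>This multiple of \<open>k\<close> lies exactly on the separating hyperplane,
        contradicting strict separation from the cone.\<close>
      have "(\<beta> / inner d k) *\<^sub>R k \<in> ?K"
        using neg \<open>\<beta> < 0\<close> that
        by (intro convex_cone_hull_mul hull_inc) (auto simp: zero_le_divide_iff)
      from d(2)[OF this] neg show False by simp
    qed
    have "A *v d = 0"
    proof (subst vec_eq_iff, intro allI)
      fix i
      have "inner d (transpose A *v axis i 1) \<ge> 0" "inner d (- (transpose A *v axis i 1)) \<ge> 0"
        by (intro pos; force simp: G_def)+
      then show "(A *v d) $ i = 0 $ i"
        by (simp add: inner_transpose_mult inner_axis del: transpose_matrix_vector)
    qed
    have d_nonneg: "d $ j \<ge> 0" if "x $ j = 0" for j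
      using pos[of "axis j 1"] that by (simp add: G_def inner_axis)
    have x_nonneg: "x $ j \<ge> 0" for j
      using x by (simp add: feasible_set_def less_eq_vec_def)
    \<comment> \<open>\<open>d\<close> is a feasible direction: it does not decrease the zero
      coordinates, and the positive ones tolerate a small step. Its negative product with the
      gradient then violates \<open>var\<close>.\<close>
    have "eventually (\<lambda>t. \<forall>j. 0 \<le> x $ j + t * d $ j) (at_right (0::real))"
    proof (rule eventually_all_finite)
      fix j
      show "eventually (\<lambda>t. 0 \<le> x $ j + t * d $ j) (at_right (0::real))"
      proof (cases "x $ j = 0")
        case True
        then show ?thesis
          using d_nonneg[of j] by (intro eventually_at_rightI[of 0 1]) auto
      next
        case False
        then have "0 < x $ j" using x_nonneg[of j] by simp
        moreover have "((\<lambda>t. x $ j + t * d $ j) \<longlongrightarrow> x $ j + 0 * d $ j) (at_right 0)"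
          by (intro tendsto_intros)
        ultimately show ?thesis
          by (auto dest!: order_tendstoD(1) elim: eventually_mono)
      qed
    qed
    then have "eventually (\<lambda>t. t > 0 \<and> (\<forall>j. 0 \<le> x $ j + t * d $ j)) (at_right (0::real))"
      by (simp add: eventually_conj eventually_at_right_less)
    then obtain t :: real where t: "t > 0" "\<And>j. 0 \<le> x $ j + t * d $ j"
      using eventually_happens[of _ "at_right (0::real)"] by auto
    have "x + t *\<^sub>R d \<in> feasible_set A b"
      using x t \<open>A *v d = 0\<close>
      by (simp add: feasible_set_def less_eq_vec_def matrix_vector_right_distrib matrix_vector_mult_scaleR)
    from var[OF this] have "t * inner d ?g \<ge> 0" by (simp add: inner_commute)
    with t d(1) \<open>\<beta> < 0\<close> show False by (simp add: zero_le_mult_iff)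
  qed
  \<comment> \<open>The vectors that admit multipliers with complementarity form a convex cone
    containing the generators, hence all of \<open>?K\<close>.\<close>
  moreover have "?K \<subseteq> {v. \<exists>\<mu>. 0 \<le> v - transpose A *v \<mu> \<and> (\<forall>j. x $ j \<noteq> 0 \<longrightarrow> (v - transpose A *v \<mu>) $ j = 0)}"
    (is "_ \<subseteq> ?S")
  proof (rule hull_minimal)
    have "v \<in> ?S" if "0 \<le> v - transpose A *v \<mu>" "\<And>j. x $ j \<noteq> 0 \<Longrightarrow> (v - transpose A *v \<mu>) $ j = 0" for v \<mu>
      using that by blast
    note S_I = this
    show "G \<subseteq> ?S"
    proof
      fix v assume "v \<in> G"
      then consider (a) i where "v = transpose A *v axis i 1" | (b) i where "v = - (transpose A *v axis i 1)"
        | (c) j where "v = axis j 1" "x $ j = 0"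
        by (auto simp: G_def)
      then show "v \<in> ?S"
      proof cases
        case a
        then show ?thesis by (intro S_I[of _ "axis i 1"]) auto
      next
        case b
        then have "v = transpose A *v (- axis i 1)"
          using matrix_vector_mult_scaleR[of "transpose A" "-1" "axis i 1"] by simp
        then show ?thesis by (intro S_I[of _ "- axis i 1"]) auto
      next
        case c
        then show ?thesis
          by (intro S_I[of _ 0]) (auto simp: axis_def less_eq_vec_def)
      qed
    qed
    show "convex_cone ?S"
      unfolding convex_cone_iff
    proof (intro conjI ballI allI impI)
      show "0 \<in> ?S" by (rule S_I[of _ 0]) auto
      fix v assume "v \<in> ?S"
      then obtain \<mu> where \<mu>: "0 \<le> v - transpose A *v \<mu>" "\<And>j. x $ j \<noteq> 0 \<Longrightarrow> (v - transpose A *v \<mu>) $ j = 0"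
        by blast
      show "v + w \<in> ?S" if "w \<in> ?S" for w
      proof -
        from that obtain \<nu> where \<nu>: "0 \<le> w - transpose A *v \<nu>"
          "\<And>j. x $ j \<noteq> 0 \<Longrightarrow> (w - transpose A *v \<nu>) $ j = 0"
          by blast
        have eq: "v + w - transpose A *v (\<mu> + \<nu>) = (v - transpose A *v \<mu>) + (w - transpose A *v \<nu>)"
          by (simp add: matrix_vector_right_distrib)
        show ?thesis
          by (rule S_I[of _ "\<mu> + \<nu>"]; unfold eq) (use \<mu> \<nu> in \<open>auto simp: less_eq_vec_def add_nonneg_nonneg\<close>)
      qed
      show "c *\<^sub>R v \<in> ?S" if "0 \<le> c" for c :: real
      proof -
        have eq: "c *\<^sub>R v - transpose A *v (c *\<^sub>R \<mu>) = c *\<^sub>R (v - transpose A *v \<mu>)"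
          by (simp add: matrix_vector_mult_scaleR scaleR_diff_right)
        show ?thesis
          by (rule S_I[of _ "c *\<^sub>R \<mu>"]; unfold eq)
            (use \<mu> that in \<open>auto simp: less_eq_vec_def intro!: mult_left_mono\<close>)
      qed
    qed
  qed
  ultimately obtain \<mu> where "0 \<le> ?g - transpose A *v \<mu>" "\<forall>j. x $ j \<noteq> 0 \<longrightarrow> (?g - transpose A *v \<mu>) $ j = 0"
    by blast
  then show ?thesis
    using x unfolding first_order_stationary_def feasible_set_def
    by (intro exI[of _ \<mu>]) (auto simp: vec_eq_iff)
qed

section \<open>Mean value theorem and backtracking for projected steps\<close>

lemma gradient_mvt:
  fixes \<phi> :: "'a::euclidean_space \<Rightarrow> real"
  assumes "\<And>z. \<phi> differentiable (at z)"
  obtains \<xi> where "\<xi> \<in> closed_segment x y" "\<phi> y - \<phi> x = inner (gradient \<phi> \<xi>) (y - x)"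
proof -
  have "\<exists>s\<in>{0..1}. \<phi> (x + 1 *\<^sub>R (y - x)) - \<phi> (x + 0 *\<^sub>R (y - x)) =
      inner ((1 - 0) *\<^sub>R (y - x)) (gradient \<phi> (x + s *\<^sub>R (y - x)))"
  proof (rule mvt_very_simple)
    fix s :: real
    have "((\<lambda>s. x + s *\<^sub>R (y - x)) has_derivative (\<lambda>s. s *\<^sub>R (y - x))) (at s within {0..1})"
      by (auto intro!: derivative_eq_intros)
    moreover have "(\<phi> has_derivative (\<lambda>h. inner h (gradient \<phi> (x + s *\<^sub>R (y - x))))) (at (x + s *\<^sub>R (y - x)))"
      using GDERIV_gradient[OF assms] unfolding gderiv_def .
    ultimately show "((\<lambda>s. \<phi> (x + s *\<^sub>R (y - x))) has_derivative
        (\<lambda>t. inner (t *\<^sub>R (y - x)) (gradient \<phi> (x + s *\<^sub>R (y - x))))) (at s within {0..1})"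
      by (rule has_derivative_compose)
  qed simp
  then obtain s :: real where "s \<in> {0..1}" "\<phi> y - \<phi> x = inner (gradient \<phi> (x + s *\<^sub>R (y - x))) (y - x)"
    by (auto simp: inner_commute)
  moreover from this have "x + s *\<^sub>R (y - x) \<in> closed_segment x y"
    by (auto simp: in_segment algebra_simps intro!: exI[of _ s])
  ultimately show thesis using that by blast
qed

text \<open>The bound \<open>j \<ge> 1\<close> is for the projection search, which excludes the unit
  step; the retraction search may use the same exponent.\<close>

lemma half_power_le:
  assumes "(\<tau>::real) > 0"
  obtains j where "j \<ge> 1" "(1/2) ^ j \<le> \<tau>"
proof -
  obtain n where "(1/2::real) ^ n < \<tau>"
    using real_arch_pow_inv[OF assms, of "1/2"] by auto
  moreover have "(1/2::real) ^ Suc n \<le> (1/2) ^ n" by simp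
  ultimately show thesis by (intro that[of "Suc n"]) linarith+
qed

lemma proj_step_feasible:
  fixes \<phi> :: "real ^ 'n \<Rightarrow> real" and A :: "real ^ 'n ^ 'm"
  assumes "x \<in> feasible_set A b"
  shows "proj_step \<phi> A b t x \<in> feasible_set A b"
  unfolding proj_step_def using assms closed_feasible_set by (intro closest_point_in_set) auto

lemma proj_step_dot:
  fixes \<phi> :: "real ^ 'n \<Rightarrow> real" and A :: "real ^ 'n ^ 'm"
  shows "z \<in> feasible_set A b \<Longrightarrow> inner (x - t *\<^sub>R gradient \<phi> x - proj_step \<phi> A b t x) (z - proj_step \<phi> A b t x) \<le> 0"
  unfolding proj_step_def by (rule closest_point_dot[OF convex_feasible_set closed_feasible_set])

text \<open>The obtuse angle property of the projection, tested at \<open>x\<close> itself.\<close>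

lemma proj_step_descent:
  fixes \<phi> :: "real ^ 'n \<Rightarrow> real" and A :: "real ^ 'n ^ 'm"
  assumes x: "x \<in> feasible_set A b"
  shows "t * inner (gradient \<phi> x) (proj_step \<phi> A b t x - x) \<le> - (norm (proj_step \<phi> A b t x - x))\<^sup>2"
  using proj_step_dot[OF x, of x t \<phi>] unfolding power2_norm_eq_inner
  by (simp add: inner_diff_left inner_diff_right algebra_simps inner_commute)

lemma norm_proj_step_le:
  fixes \<phi> :: "real ^ 'n \<Rightarrow> real" and A :: "real ^ 'n ^ 'm"
  assumes x: "x \<in> feasible_set A b" and "t > 0"
  shows "norm (proj_step \<phi> A b t x - x) \<le> t * norm (gradient \<phi> x)"
proof -
  let ?p = "proj_step \<phi> A b t x - x"
  have "(norm ?p)\<^sup>2 \<le> t * (- inner (gradient \<phi> x) ?p)"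
    using proj_step_descent[OF x, of t \<phi>] by simp
  also have "\<dots> \<le> t * (norm (gradient \<phi> x) * norm ?p)"
    using assms Cauchy_Schwarz_ineq2[of "gradient \<phi> x" ?p] by (intro mult_left_mono) auto
  finally have "norm ?p * norm ?p \<le> (t * norm (gradient \<phi> x)) * norm ?p"
    by (simp add: power2_eq_square)
  then show ?thesis
    using assms by (cases "?p = 0") auto
qed

text \<open>Each projected point is tested against the other. Adding the inequality for step 1,
  weighted by \<open>t\<close>, to the one for step \<open>t\<close> cancels the gradient;
  Cauchy-Schwarz leaves \<open>(norm v - norm u) * (norm v - t * norm u) \<le> 0\<close>, which
  traps \<open>norm v\<close> between the two roots.\<close>

lemma proj_step_compare:
  fixes \<phi> :: "real ^ 'n \<Rightarrow> real" and A :: "real ^ 'n ^ 'm"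
  assumes x: "x \<in> feasible_set A b" and t: "0 < t" "t \<le> 1"
  shows "t * norm (proj_step \<phi> A b 1 x - x) \<le> norm (proj_step \<phi> A b t x - x)"
    and "norm (proj_step \<phi> A b t x - x) \<le> norm (proj_step \<phi> A b 1 x - x)"
proof -
  define u where "u = proj_step \<phi> A b 1 x - x"
  define v where "v = proj_step \<phi> A b t x - x"
  let ?g = "gradient \<phi> x"
  have p: "proj_step \<phi> A b 1 x = x + u" "proj_step \<phi> A b t x = x + v"
    by (auto simp: u_def v_def)
  have "inner (- ?g - u) (v - u) \<le> 0"
    using proj_step_dot[OF proj_step_feasible[OF x, of \<phi> t], of x 1 \<phi>] unfolding p by simp
  then have "t * inner (- ?g - u) (v - u) \<le> 0"
    using assms by (simp add: mult_nonneg_nonpos)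
  moreover have "inner (- (t *\<^sub>R ?g) - v) (u - v) \<le> 0"
    using proj_step_dot[OF proj_step_feasible[OF x, of \<phi> 1], of x t \<phi>] unfolding p by simp
  ultimately have "inner v v - (1 + t) * inner u v + t * inner u u \<le> 0"
    by (simp add: inner_diff_left inner_diff_right algebra_simps inner_commute)
  moreover have "(1 + t) * inner u v \<le> (1 + t) * (norm u * norm v)"
    using assms norm_cauchy_schwarz[of u v] by (intro mult_left_mono) auto
  ultimately have *: "(norm v - norm u) * (norm v - t * norm u) \<le> 0"
    by (simp add: dot_square_norm power2_eq_square algebra_simps)
  have "t * norm u \<le> norm u"
    using assms by (simp add: mult_left_le_one_le)
  with * have "t * norm u \<le> norm v \<and> norm v \<le> norm u"
    by (auto simp: mult_le_0_iff)
  then show "t * norm u \<le> norm v" "norm v \<le> norm u" by auto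
qed

lemma proj_residual_ge:
  fixes \<phi> :: "real ^ 'n \<Rightarrow> real" and A :: "real ^ 'n ^ 'm"
  assumes "x \<in> feasible_set A b" "0 < t" "t \<le> 1"
  shows "norm (proj_step \<phi> A b 1 x - x) \<le> proj_residual \<phi> A b t x"
  using proj_step_compare(1)[OF assms, of \<phi>] assms(2) by (simp add: proj_residual_def pos_le_divide_eq mult.commute)

lemma stationary_if_proj_step_fixed:
  fixes \<phi> :: "real ^ 'n \<Rightarrow> real" and A :: "real ^ 'n ^ 'm"
  assumes x: "x \<in> feasible_set A b" and fixed: "proj_step \<phi> A b 1 x = x"
  shows "first_order_stationary \<phi> A b x"
proof (rule first_order_stationaryI[OF x])
  show "inner (gradient \<phi> x) (z - x) \<ge> 0" if "z \<in> feasible_set A b" for z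
    using proj_step_dot[OF that, of x 1 \<phi>] by (simp add: fixed)
qed

text \<open>The projection inequality yields a first-order decrease of \<open>t\<close> times the
  squared residual, of which the test asks only the fraction \<open>\<delta>\<close>. Near
  \<open>xs\<close> the residual is at least \<open>c\<close> for all \<open>t \<le> 1\<close>, so
  the remaining fraction absorbs the variation of the gradient along the step.\<close>

lemma proj_armijo_local:
  fixes \<phi> :: "real ^ 'n \<Rightarrow> real" and A :: "real ^ 'n ^ 'm"
  assumes \<phi>: "continuously_differentiable \<phi>"
    and xs: "xs \<in> feasible_set A b" "proj_step \<phi> A b 1 xs \<noteq> xs" and "\<delta> < 1"
  obtains r \<tau> c where "r > 0" "\<tau> > 0" "\<tau> \<le> 1" "c > 0"
    "\<And>x. x \<in> feasible_set A b \<Longrightarrow> dist x xs < r \<Longrightarrow> c \<le> norm (proj_step \<phi> A b 1 x - x)"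
    "\<And>x t. x \<in> feasible_set A b \<Longrightarrow> dist x xs < r \<Longrightarrow> 0 < t \<Longrightarrow> t \<le> \<tau> \<Longrightarrow>
       \<phi> (proj_step \<phi> A b t x) \<le> \<phi> x - t * \<delta> * (proj_residual \<phi> A b t x)\<^sup>2"
proof -
  define c where "c = norm (proj_step \<phi> A b 1 xs - xs) / 2"
  have "c > 0" using xs by (simp add: c_def)
  have cont: "isCont (gradient \<phi>) z" for z
    using \<phi> by (simp add: continuously_differentiable_def continuous_on_eq_continuous_at)
  have "isCont (\<lambda>x. norm (proj_step \<phi> A b 1 x - x)) xs"
    unfolding proj_step_def
    by (intro continuous_intros isCont_o2[OF _ continuous_at_closest_point] cont
        convex_feasible_set closed_feasible_set) (use xs in auto)
  then have "((\<lambda>x. norm (proj_step \<phi> A b 1 x - x)) \<longlongrightarrow> norm (proj_step \<phi> A b 1 xs - xs)) (nhds xs)"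
    unfolding isCont_def by (rule tendsto_at_iff_tendsto_nhds[THEN iffD1])
  moreover have "c < norm (proj_step \<phi> A b 1 xs - xs)"
    using \<open>c > 0\<close> by (simp add: c_def)
  ultimately have "eventually (\<lambda>x. c < norm (proj_step \<phi> A b 1 x - x)) (nhds xs)"
    by (rule order_tendstoD(1))
  then obtain r1 where r1: "r1 > 0" "\<And>x. dist x xs < r1 \<Longrightarrow> c < norm (proj_step \<phi> A b 1 x - x)"
    by (auto simp: eventually_nhds_metric)
  \<comment> \<open>Two gradients that are \<open>\<kappa>\<close>-close to the one at
    \<open>xs\<close> differ by at most \<open>2 * \<kappa> = (1 - \<delta>) * c\<close>, exactly
    the slack available.\<close>
  define \<kappa> where "\<kappa> = (1 - \<delta>) * c / 2"
  have "\<kappa> > 0" using \<open>c > 0\<close> \<open>\<delta> < 1\<close> by (simp add: \<kappa>_def)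
  from cont[of xs] this obtain \<rho> where \<rho>: "\<rho> > 0" "\<And>x. dist x xs < \<rho> \<Longrightarrow> dist (gradient \<phi> x) (gradient \<phi> xs) < \<kappa>"
    unfolding continuous_at_eps_delta by metis
  define \<gamma> where "\<gamma> = norm (gradient \<phi> xs) + \<kappa>"
  have "\<gamma> > 0" using \<open>\<kappa> > 0\<close> by (simp add: \<gamma>_def add_nonneg_pos)
  \<comment> \<open>A step moves by at most \<open>t * \<gamma> \<le> \<rho> / 2\<close>; starting
    within \<open>\<rho> / 2\<close> of \<open>xs\<close>, the whole segment stays in the ball where
    the gradient is controlled.\<close>
  define \<tau> where "\<tau> = min 1 (\<rho> / (2 * \<gamma>))"
  show thesis
  proof (rule that[of "min r1 (\<rho> / 2)" \<tau> c])
    show "min r1 (\<rho> / 2) > 0" "\<tau> > 0" "\<tau> \<le> 1" "c > 0"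
      using r1 \<rho> \<open>\<gamma> > 0\<close> \<open>c > 0\<close> by (auto simp: \<tau>_def)
    show "c \<le> norm (proj_step \<phi> A b 1 x - x)" if "dist x xs < min r1 (\<rho> / 2)" for x
      using r1(2)[of x] that by simp
    fix x t assume x: "x \<in> feasible_set A b" "dist x xs < min r1 (\<rho> / 2)" and t: "0 < t" "t \<le> \<tau>"
    let ?p = "proj_step \<phi> A b t x"
    let ?h = "proj_residual \<phi> A b t x"
    have t1: "t \<le> 1" "t * \<gamma> \<le> \<rho> / 2"
      using t \<open>\<gamma> > 0\<close> by (auto simp: \<tau>_def field_simps)
    have "norm (gradient \<phi> x) \<le> \<gamma>"
      using \<rho>(2)[of x] x(2) \<rho>(1) norm_triangle_ineq2[of "gradient \<phi> x" "gradient \<phi> xs"]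
      by (simp add: \<gamma>_def dist_norm)
    then have "norm (?p - x) \<le> t * \<gamma>"
      using norm_proj_step_le[OF x(1) t(1), of \<phi>] t(1) by (meson mult_left_mono less_imp_le order_trans)
    with t1 x(2) have p_near: "dist ?p xs < \<rho>"
      using dist_triangle[of ?p xs x] by (simp add: dist_norm)
    have "\<And>z. \<phi> differentiable (at z)"
      using \<phi> by (simp add: continuously_differentiable_def)
    then obtain \<xi> where \<xi>: "\<xi> \<in> closed_segment x ?p" "\<phi> ?p - \<phi> x = inner (gradient \<phi> \<xi>) (?p - x)"
      by (rule gradient_mvt)
    have "closed_segment x ?p \<subseteq> ball xs \<rho>"
      using p_near x(2) \<rho>(1) by (intro closed_segment_subset) (auto simp: dist_commute)
    then have "dist (gradient \<phi> \<xi>) (gradient \<phi> xs) < \<kappa>"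
      using \<xi>(1) by (intro \<rho>(2)) (auto simp: dist_commute)
    moreover have "dist (gradient \<phi> x) (gradient \<phi> xs) < \<kappa>"
      using x(2) \<rho>(1) by (intro \<rho>(2)) auto
    ultimately have diff: "norm (gradient \<phi> \<xi> - gradient \<phi> x) \<le> 2 * \<kappa>"
      using dist_triangle2[of "gradient \<phi> \<xi>" "gradient \<phi> x" "gradient \<phi> xs"] by (simp add: dist_norm)
    have np: "norm (?p - x) = t * ?h"
      using t by (simp add: proj_residual_def)
    have "?h \<ge> c"
      using proj_residual_ge[OF x(1) t(1) t1(1), of \<phi>] r1(2)[of x] x(2) by simp
    have "t * inner (gradient \<phi> x) (?p - x) \<le> t * (- t * ?h\<^sup>2)"
      using proj_step_descent[OF x(1), of t \<phi>] unfolding np by (simp add: power2_eq_square mult_ac)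
    then have 1: "inner (gradient \<phi> x) (?p - x) \<le> - t * ?h\<^sup>2"
      using t(1) by (simp only: mult_le_cancel_left_pos)
    have "inner (gradient \<phi> \<xi> - gradient \<phi> x) (?p - x) \<le> (2 * \<kappa>) * norm (?p - x)"
      using norm_cauchy_schwarz diff by (meson mult_right_mono norm_ge_zero order_trans)
    also have "\<dots> = t * ((1 - \<delta>) * c) * ?h"
      by (simp add: np \<kappa>_def)
    also have "\<dots> \<le> t * ((1 - \<delta>) * ?h) * ?h"
      using \<open>?h \<ge> c\<close> \<open>c > 0\<close> t \<open>\<delta> < 1\<close> by (intro mult_right_mono mult_left_mono) auto
    finally have "inner (gradient \<phi> \<xi>) (?p - x) \<le> - t * ?h\<^sup>2 + t * ((1 - \<delta>) * ?h) * ?h"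
      using 1 by (simp add: inner_diff_left)
    then show "\<phi> ?p \<le> \<phi> x - t * \<delta> * ?h\<^sup>2"
      using \<xi>(2) by (simp add: power2_eq_square algebra_simps)
  qed
qed

text \<open>A fixed exponent \<open>n\<close> passes the test at every nearby point, so the least
  accepted exponent is at most \<open>n\<close> and the step size at least
  \<open>(1/2) ^ n\<close>.\<close>

lemma proj_stepsize_decrease_local:
  fixes \<phi> :: "real ^ 'n \<Rightarrow> real" and A :: "real ^ 'n ^ 'm"
  assumes \<phi>: "continuously_differentiable \<phi>"
    and xs: "xs \<in> feasible_set A b" "proj_step \<phi> A b 1 xs \<noteq> xs" and \<delta>: "0 < \<delta>" "\<delta> < 1"
  obtains r \<eta> where "r > 0" "\<eta> > 0"
    "\<And>x. x \<in> feasible_set A b \<Longrightarrow> dist x xs < r \<Longrightarrow>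
       \<phi> (proj_step \<phi> A b (proj_stepsize \<phi> A b \<delta> x) x) \<le> \<phi> x - \<eta>"
proof -
  obtain r \<tau> c where r: "r > 0" "\<tau> > 0" "\<tau> \<le> 1" "c > 0"
    and c: "\<And>x. x \<in> feasible_set A b \<Longrightarrow> dist x xs < r \<Longrightarrow> c \<le> norm (proj_step \<phi> A b 1 x - x)"
    and arm: "\<And>x t. x \<in> feasible_set A b \<Longrightarrow> dist x xs < r \<Longrightarrow> 0 < t \<Longrightarrow> t \<le> \<tau> \<Longrightarrow>
       \<phi> (proj_step \<phi> A b t x) \<le> \<phi> x - t * \<delta> * (proj_residual \<phi> A b t x)\<^sup>2"
    using proj_armijo_local[OF \<phi> xs \<delta>(2)] by metis
  obtain n where n: "n \<ge> 1" "(1/2) ^ n \<le> \<tau>"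
    using half_power_le[OF \<open>\<tau> > 0\<close>] .
  show thesis
  proof (rule that[of r "(1/2) ^ n * \<delta> * c\<^sup>2"])
    fix x assume x: "x \<in> feasible_set A b" "dist x xs < r"
    let ?P = "\<lambda>j. 1 \<le> j \<and> \<phi> (proj_step \<phi> A b ((1/2) ^ j) x)
        \<le> \<phi> x - (1/2) ^ j * \<delta> * (proj_residual \<phi> A b ((1/2) ^ j) x)\<^sup>2"
    define j where "j = (LEAST j. ?P j)"
    have "?P n" using n arm[OF x] by simp
    then have j: "?P j" "j \<le> n"
      unfolding j_def by (rule LeastI, rule Least_le)
    have "c \<le> proj_residual \<phi> A b ((1/2) ^ j) x"
      using c[OF x] proj_residual_ge[OF x(1), of "(1/2) ^ j" \<phi>] by (simp add: power_le_one)
    then have "(1/2) ^ n * \<delta> * c\<^sup>2 \<le> (1/2) ^ j * \<delta> * (proj_residual \<phi> A b ((1/2) ^ j) x)\<^sup>2"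
      using \<delta> r j(2) by (intro mult_mono power_mono power_decreasing) auto
    then show "\<phi> (proj_step \<phi> A b (proj_stepsize \<phi> A b \<delta> x) x) \<le> \<phi> x - (1/2) ^ n * \<delta> * c\<^sup>2"
      using j(1) unfolding proj_stepsize_def j_def[symmetric] by linarith
  qed (use r \<delta> in auto)
qed

text \<open>At a fixed point of the unit step all shorter steps are fixed too, so the value is
  unchanged whichever exponent is selected. Elsewhere the local decrease applies with
  \<open>x\<close> as its own centre.\<close>

lemma proj_stepsize_nonincreasing:
  fixes \<phi> :: "real ^ 'n \<Rightarrow> real" and A :: "real ^ 'n ^ 'm"
  assumes \<phi>: "continuously_differentiable \<phi>"
    and x: "x \<in> feasible_set A b" and \<delta>: "0 < \<delta>" "\<delta> < 1"
  shows "\<phi> (proj_step \<phi> A b (proj_stepsize \<phi> A b \<delta> x) x) \<le> \<phi> x"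
proof (cases "proj_step \<phi> A b 1 x = x")
  case True
  have "proj_step \<phi> A b t x = x" if "0 < t" "t \<le> 1" for t
    using proj_step_compare(2)[OF x that, of \<phi>] by (simp add: True)
  then show ?thesis
    by (simp add: proj_stepsize_def power_le_one)
next
  case False
  then obtain r \<eta> where "r > 0" "\<eta> > 0"
    "\<And>x'. x' \<in> feasible_set A b \<Longrightarrow> dist x' x < r \<Longrightarrow>
       \<phi> (proj_step \<phi> A b (proj_stepsize \<phi> A b \<delta> x') x') \<le> \<phi> x' - \<eta>"
    using proj_stepsize_decrease_local[OF \<phi> x _ \<delta>] by metis
  from this(2) this(3)[OF x] this(1) show ?thesis by simp
qed

section \<open>Retraction steps\<close>

lemma stratum_eq: "y \<in> stratum A b z \<Longrightarrow> stratum A b y = stratum A b z"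
  by (auto simp: stratum_def)

lemma stratum_self: "z \<in> lifted_set A b \<Longrightarrow> z \<in> stratum A b z"
  by (simp add: stratum_def)

lemma stratum_subset_lifted_set: "stratum A b z \<subseteq> lifted_set A b"
  by (auto simp: stratum_def)

lemma tangent_bundle_stratum:
  "(y, h) \<in> tangent_bundle (stratum A b z) \<longleftrightarrow> y \<in> stratum A b z \<and> h \<in> stratum_tangent A y"
  using tangent_space_stratum[of y A b] stratum_eq[of y A b z] stratum_subset_lifted_set[of A b z]
  by (auto simp: tangent_bundle_def)

text \<open>\<open>Ck\<close> gives continuity for one direction at a time. Expanding the direction
  in the basis makes the derivative jointly continuous in point and direction.\<close>

lemma Ck_continuous_on_frechet_derivative:
  assumes "open U" "Ck 1 U F"
  shows "continuous_on (U \<times> UNIV) (\<lambda>p. frechet_derivative F (at (fst p)) (snd p))"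
proof -
  have D: "(F has_derivative frechet_derivative F (at w)) (at w)" if "w \<in> U" for w
    using assms that by (simp add: frechet_derivative_works[symmetric])
  have eq: "(\<Sum>i\<in>Basis. (snd p \<bullet> i) *\<^sub>R frechet_derivative F (at (fst p)) i)
      = frechet_derivative F (at (fst p)) (snd p)" if "p \<in> U \<times> UNIV" for p
  proof -
    have "fst p \<in> U" using that by auto
    then have lin: "linear (frechet_derivative F (at (fst p)))"
      by (rule has_derivative_linear[OF D])
    have "frechet_derivative F (at (fst p)) (\<Sum>i\<in>Basis. (snd p \<bullet> i) *\<^sub>R i) =
        (\<Sum>i\<in>Basis. (snd p \<bullet> i) *\<^sub>R frechet_derivative F (at (fst p)) i)"
      by (simp add: linear_sum[OF lin] linear_scale[OF lin])
    then show ?thesis by (simp add: euclidean_representation)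
  qed
  have "continuous_on (U \<times> UNIV) (\<lambda>p. \<Sum>i\<in>Basis. (snd p \<bullet> i) *\<^sub>R frechet_derivative F (at (fst p)) i)"
  proof (intro continuous_on_sum continuous_on_scaleR continuous_on_inner continuous_on_snd
      continuous_on_id continuous_on_const)
    fix i
    have "continuous_on U (\<lambda>w. frechet_derivative F (at w) i)"
      using assms by simp
    then show "continuous_on (U \<times> UNIV) (\<lambda>p. frechet_derivative F (at (fst p)) i)"
      by (rule continuous_on_compose2) (auto intro: continuous_intros)
  qed
  then show ?thesis by (rule continuous_on_eq) (rule eq)
qed

text \<open>\<open>F\<close> is tied to \<open>R\<close> only on the tangent bundle. The line of
  points \<open>(z, s *\<^sub>R h)\<close> stays in the bundle because the tangent space is a
  subspace, so the derivatives of \<open>F\<close> and \<open>R\<close> along it coincide.\<close>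

lemma retraction_extension_derivative:
  assumes R: "manifold_retraction M R" and T: "subspace (tangent_space M z)"
    and z: "z \<in> M" and h: "h \<in> tangent_space M z"
    and U: "open U" "(z, 0) \<in> U" and F: "\<And>q. q \<in> tangent_bundle M \<inter> U \<Longrightarrow> F q = R q"
    and D: "(F has_derivative F') (at (z, 0))"
  shows "F' (0, h) = h"
proof -
  let ?S = "(\<lambda>s::real. (z, s *\<^sub>R h)) -` U"
  have "((\<lambda>s::real. (z, s *\<^sub>R h)) has_derivative (\<lambda>s. (0, s *\<^sub>R h))) (at 0)"
    by (auto intro!: derivative_eq_intros)
  from has_derivative_compose[OF this, of F F'] D
  have 1: "((\<lambda>s::real. F (z, s *\<^sub>R h)) has_derivative (\<lambda>s. F' (0, s *\<^sub>R h))) (at 0)"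
    by simp
  have "((\<lambda>h. R (z, h)) has_derivative (\<lambda>h. h)) (at 0 within tangent_space M z)"
    using R z by (simp add: manifold_retraction_def)
  moreover have "range (\<lambda>s::real. s *\<^sub>R h) \<subseteq> tangent_space M z"
    using T h by (auto intro: subspace_scale)
  ultimately have "((\<lambda>h. R (z, h)) has_derivative (\<lambda>h. h)) (at (0 *\<^sub>R h) within range (\<lambda>s::real. s *\<^sub>R h))"
    by (simp add: has_derivative_subset)
  moreover have "((\<lambda>s::real. s *\<^sub>R h) has_derivative (\<lambda>s. s *\<^sub>R h)) (at 0)"
    by (auto intro!: derivative_eq_intros)
  ultimately have 2: "((\<lambda>s::real. R (z, s *\<^sub>R h)) has_derivative (\<lambda>s. s *\<^sub>R h)) (at 0)"
    by (rule has_derivative_in_compose[rotated])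
  have "open ?S"
    by (rule open_vimage[OF U(1)]) (intro continuous_intros)
  moreover have "0 \<in> ?S" using U(2) by simp
  ultimately have "((\<lambda>s::real. F (z, s *\<^sub>R h)) has_derivative (\<lambda>s. s *\<^sub>R h)) (at 0)"
  proof (rule has_derivative_transform_within_open[OF 2])
    fix s :: real assume "s \<in> ?S"
    then show "R (z, s *\<^sub>R h) = F (z, s *\<^sub>R h)"
      using z h T by (intro F[symmetric]) (auto simp: tangent_bundle_def intro: subspace_scale)
  qed
  from has_derivative_unique[OF 1 this] have "(\<lambda>s::real. F' (0, s *\<^sub>R h)) = (\<lambda>s. s *\<^sub>R h)" .
  from fun_cong[OF this, of 1] show ?thesis by simp
qed

text \<open>Near the zero vector a retraction agrees with a \<open>C\<^sup>1\<close> map \<open>F\<close> on the ambient space. The mean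
  value theorem turns the Armijo condition into a strict inequality between continuous functions of
  the base point and the direction, which holds at the limit point because the derivative of
  \<open>F\<close> in the fibre direction is the identity there.\<close>

lemma retr_armijo_local:
  fixes A :: "real ^ 'n ^ 'm"
  assumes \<phi>: "continuously_differentiable \<phi>" and z: "z \<in> lifted_set A b"
    and R: "manifold_retraction (stratum A b z) R"
    and g: "g \<in> stratum_tangent A z" "g \<noteq> 0"
      "inner (gradient (lifted_objective \<phi>) z) g = (norm g)\<^sup>2" and \<delta>: "\<delta> < 1"
  obtains r \<tau> where "r > 0" "\<tau> > 0"
    "\<And>y u t. y \<in> stratum A b z \<Longrightarrow> u \<in> stratum_tangent A y \<Longrightarrow> dist y z < r \<Longrightarrow> dist u g < r \<Longrightarrow>
       0 < t \<Longrightarrow> t \<le> \<tau> \<Longrightarrow>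
       lifted_objective \<phi> (R (y, - t *\<^sub>R u)) \<le> lifted_objective \<phi> y - t * \<delta> * (norm u)\<^sup>2"
proof -
  let ?M = "stratum A b z"
  let ?f = "lifted_objective \<phi>"
  have z0: "(z, 0) \<in> tangent_bundle ?M"
    using stratum_self[OF z] subspace_stratum_tangent subspace_0 by (auto simp: tangent_bundle_stratum)
  then obtain U F where U: "open U" "(z, 0) \<in> U" and Ck: "\<And>k. Ck k U F"
    and F: "\<And>q. q \<in> tangent_bundle ?M \<inter> U \<Longrightarrow> F q = R q"
    using R unfolding manifold_retraction_def smooth_map_on_def by metis
  let ?D = "\<lambda>w. frechet_derivative F (at w)"
  have D: "(F has_derivative ?D w) (at w)" if "w \<in> U" for w
    using Ck[of 1] that by (simp add: frechet_derivative_works[symmetric])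
  have F0: "F (y, 0) = y" if "y \<in> ?M" "(y, 0) \<in> U" for y
  proof -
    have "(y, 0) \<in> tangent_bundle ?M"
      using that(1) subspace_stratum_tangent subspace_0 by (auto simp: tangent_bundle_stratum)
    then show ?thesis
      using F[of "(y, 0)"] that R by (simp add: manifold_retraction_def)
  qed
  have f_cd: "continuously_differentiable ?f"
    using \<phi> by (rule continuously_differentiable_lifted_objective)
  \<comment> \<open>The point at which \<open>F\<close> is differentiated and the direction are
    separate arguments, because the mean value theorem evaluates the derivative at
    \<open>(y, - s *\<^sub>R u)\<close> but in direction \<open>u\<close>.\<close>
  define \<Psi> where "\<Psi> p = inner (gradient ?f (F (fst p))) (?D (fst p) (0, snd p)) - \<delta> * (norm (snd p))\<^sup>2"
    for p :: "((real ^ 'n) \<times> (real ^ 'n)) \<times> (real ^ 'n)"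
  have contF: "continuous_on (U \<times> UNIV) (\<lambda>p. gradient ?f (F (fst p)))"
  proof (rule continuous_on_compose2[of UNIV "gradient ?f"])
    show "continuous_on UNIV (gradient ?f)"
      using f_cd by (simp add: continuously_differentiable_def)
    show "continuous_on (U \<times> UNIV) (\<lambda>p. F (fst p))"
      by (rule continuous_on_compose2[of U F]) (use Ck[of 0] in \<open>auto intro: continuous_intros\<close>)
  qed auto
  have "continuous_on (U \<times> UNIV) (\<lambda>p. ?D (fst p) (0, snd p))"
    by (rule continuous_on_compose2[OF Ck_continuous_on_frechet_derivative[OF U(1) Ck], of _ "\<lambda>p. (fst p, (0, snd p))", simplified])
       (auto intro!: continuous_intros)
  with contF have cont: "continuous_on (U \<times> UNIV) \<Psi>"
    unfolding \<Psi>_def by (intro continuous_intros)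
  have "?D (z, 0) (0, g) = g"
    by (rule retraction_extension_derivative[OF R _ stratum_self[OF z] _ U F D[OF U(2)]])
       (use g(1) in \<open>auto simp: tangent_space_stratum[OF z] subspace_stratum_tangent\<close>)
  then have "\<Psi> ((z, 0), g) = (1 - \<delta>) * (norm g)\<^sup>2"
    using g(3) by (simp add: \<Psi>_def F0[OF stratum_self[OF z] U(2)] algebra_simps)
  then have pos: "\<Psi> ((z, 0), g) > 0"
    using g(2) \<delta> by simp
  have "open ((U \<times> UNIV) \<inter> \<Psi> -` {0<..})"
    using cont U(1) by (intro continuous_open_preimage open_Times) auto
  moreover have "((z, 0), g) \<in> (U \<times> UNIV) \<inter> \<Psi> -` {0<..}"
    using pos U(2) by simp
  ultimately obtain \<rho> where \<rho>: "\<rho> > 0" "\<And>p. dist p ((z, 0), g) < \<rho> \<Longrightarrow> p \<in> (U \<times> UNIV) \<inter> \<Psi> -` {0<..}"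
    unfolding open_dist by blast
  \<comment> \<open>\<open>\<gamma>\<close> bounds \<open>norm u\<close> for nearby
    \<open>u\<close>, so \<open>s * norm u \<le> \<rho> / 3\<close> when
    \<open>s \<le> \<tau>\<close>. Base point, fibre point and direction each use a third of
    \<open>\<rho>\<close>.\<close>
  define \<gamma> where "\<gamma> = norm g + \<rho>"
  define \<tau> where "\<tau> = \<rho> / 3 / \<gamma>"
  have \<gamma>_pos: "\<gamma> > 0" using \<rho>(1) by (simp add: \<gamma>_def add_nonneg_pos)
  show thesis
  proof (rule that[of "\<rho> / 3" \<tau>])
    show "\<rho> / 3 > 0" "\<tau> > 0" using \<rho>(1) \<gamma>_pos by (auto simp: \<tau>_def)
    fix y u t assume y: "y \<in> ?M" "dist y z < \<rho> / 3" and u: "u \<in> stratum_tangent A y" "dist u g < \<rho> / 3"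
      and t: "0 < t" "t \<le> \<tau>"
    have near: "(y, - s *\<^sub>R u) \<in> U \<and> \<Psi> ((y, - s *\<^sub>R u), u) > 0" if "0 \<le> s" "s \<le> t" for s
    proof -
      have "norm u \<le> \<gamma>"
        using u(2) norm_triangle_ineq2[of u g] \<rho>(1) by (simp add: dist_norm \<gamma>_def)
      then have "s * norm u \<le> \<tau> * \<gamma>"
        using that t by (intro mult_mono) auto
      also have "\<dots> = \<rho> / 3" using \<gamma>_pos by (simp add: \<tau>_def)
      finally have "norm (- s *\<^sub>R u) \<le> \<rho> / 3" using that by simp
      moreover have "dist ((y, - s *\<^sub>R u), u) ((z, 0), g) \<le> dist y z + norm (- s *\<^sub>R u) + dist u g"
        unfolding dist_norm using norm_Pair_le[of "(y - z, - s *\<^sub>R u)" "u - g"] norm_Pair_le[of "y - z" "- s *\<^sub>R u"]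
        by simp
      ultimately show ?thesis
        using \<rho>(2)[of "((y, - s *\<^sub>R u), u)"] y(2) u(2) by simp
    qed
    have inTM: "(y, - s *\<^sub>R u) \<in> tangent_bundle ?M" for s
      using y u by (auto simp: tangent_bundle_stratum simp del: scaleR_minus_left
        intro: subspace_scale[OF subspace_stratum_tangent])
    have "\<exists>s\<in>{0..t}. ?f (F (y, - t *\<^sub>R u)) - ?f (F (y, - 0 *\<^sub>R u)) =
        inner (?D (y, - s *\<^sub>R u) (0, - (t - 0) *\<^sub>R u)) (gradient ?f (F (y, - s *\<^sub>R u)))"
    proof (rule mvt_very_simple)
      fix s assume s: "0 \<le> s" "s \<le> t"
      let ?w = "(y, - s *\<^sub>R u)"
      have 1: "((\<lambda>s. (y, - s *\<^sub>R u)) has_derivative (\<lambda>h. (0, - h *\<^sub>R u))) (at s within {0..t})"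
        by (auto intro!: derivative_eq_intros)
      have 2: "((\<lambda>s. F (y, - s *\<^sub>R u)) has_derivative (\<lambda>h. ?D ?w (0, - h *\<^sub>R u))) (at s within {0..t})"
        using near[OF s] by (intro has_derivative_compose[OF 1] D) simp
      have "(?f has_derivative (\<lambda>h. inner h (gradient ?f (F ?w)))) (at (F ?w))"
        using f_cd GDERIV_gradient unfolding continuously_differentiable_def gderiv_def by blast
      from has_derivative_compose[OF 2 this]
      show "((\<lambda>s. ?f (F (y, - s *\<^sub>R u))) has_derivative
        (\<lambda>h. inner (?D ?w (0, - h *\<^sub>R u)) (gradient ?f (F ?w)))) (at s within {0..t})" .
    qed (use t in simp)
    then obtain s where s: "0 \<le> s" "s \<le> t" and eq: "?f (F (y, - t *\<^sub>R u)) - ?f (F (y, - 0 *\<^sub>R u)) =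
        inner (?D (y, - s *\<^sub>R u) (0, - (t - 0) *\<^sub>R u)) (gradient ?f (F (y, - s *\<^sub>R u)))"
      by auto
    let ?w = "(y, - s *\<^sub>R u)"
    have lin: "linear (?D ?w)"
      using D near[OF s] has_derivative_linear by blast
    have "?D ?w (0, - (t - 0) *\<^sub>R u) = - t *\<^sub>R ?D ?w (0, u)"
      using linear_scale[OF lin, of "- t" "(0, u)"] by simp
    moreover have "F (y, - 0 *\<^sub>R u) = y"
      using F0[OF y(1)] near[of 0] t by simp
    moreover have "F (y, - t *\<^sub>R u) = R (y, - t *\<^sub>R u)"
      using F near[of t] inTM t by simp
    ultimately have "?f (R (y, - t *\<^sub>R u)) - ?f y = - t * inner (gradient ?f (F ?w)) (?D ?w (0, u))"
      using eq by (simp add: inner_commute)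
    also have "\<dots> \<le> - t * (\<delta> * (norm u)\<^sup>2)"
      using near[OF s] t(1) by (intro mult_left_mono_neg) (auto simp: \<Psi>_def)
    finally show "?f (R (y, - t *\<^sub>R u)) \<le> ?f y - t * \<delta> * (norm u)\<^sup>2"
      by (simp add: mult.assoc)
  qed
qed

section \<open>LDL decompositions and limits of regular points\<close>

lemma closest_point_subspace:
  fixes S :: "'a::euclidean_space set"
  assumes "subspace S"
  shows "closest_point S a \<in> S" and "x \<in> S \<Longrightarrow> inner (a - closest_point S a) x = 0"
proof -
  have S: "convex S" "closed S" "S \<noteq> {}"
    using assms by (auto simp: subspace_imp_convex closed_subspace dest: subspace_0)
  show p: "closest_point S a \<in> S"
    using S by (rule_tac closest_point_in_set)
  assume "x \<in> S"
  with p have "closest_point S a + x \<in> S" "closest_point S a - x \<in> S"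
    using assms by (auto intro: subspace_add subspace_diff)
  from this[THEN closest_point_dot[OF S(1,2), of _ a]] show "inner (a - closest_point S a) x = 0"
    by simp
qed

text \<open>The remainder lies in the span and is orthogonal to it. Vanishing \<open>q k\<close> are
  allowed: division by zero gives 0, so their terms drop out.\<close>

lemma orthogonal_expansion:
  fixes q :: "'i \<Rightarrow> 'a::real_inner"
  assumes "finite I" and orth: "\<And>i j. i \<in> I \<Longrightarrow> j \<in> I \<Longrightarrow> i \<noteq> j \<Longrightarrow> inner (q i) (q j) = 0"
    and p: "p \<in> span (q ` I)"
  shows "p = (\<Sum>k\<in>I. (inner p (q k) / (norm (q k))\<^sup>2) *\<^sub>R q k)"
proof -
  define r where "r = p - (\<Sum>k\<in>I. (inner p (q k) / (norm (q k))\<^sup>2) *\<^sub>R q k)"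
  have "r \<in> span (q ` I)"
    unfolding r_def by (intro span_diff p span_sum span_scale span_base imageI)
  moreover have "orthogonal r v" if v: "v \<in> q ` I" for v
  proof -
    obtain j where j: "j \<in> I" "v = q j" using v by blast
    have "(\<Sum>k\<in>I. (inner p (q k) / (norm (q k))\<^sup>2) * inner (q k) (q j))
        = (\<Sum>k\<in>I. if k = j then inner p (q j) else 0)"
      by (rule sum.cong) (use j orth in \<open>auto simp: power2_norm_eq_inner\<close>)
    then show ?thesis
      using j \<open>finite I\<close> by (simp add: r_def orthogonal_def inner_diff_left inner_sum_left)
  qed
  ultimately have "orthogonal r r"
    by (metis orthogonal_commute orthogonal_to_span)
  then show ?thesis by (simp add: r_def orthogonal_self)
qed

section \<open>Gram-Schmidt on the rows and the pivots\<close>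

lemma transpose_mult_eq_sum: "transpose B *v u = (\<Sum>j\<in>UNIV. u $ j *\<^sub>R B $ j)"
  for B :: "real ^ 'n ^ 'm"
  unfolding matrix_mult_sum column_transpose by (simp add: row_def scalar_mult_eq_scaleR)

text \<open>The row index type is only finite and linearly ordered, so the number of smaller indices
  serves as the measure.\<close>

lemma finite_linorder_induct:
  fixes k :: "'m::{finite,linorder}"
  assumes "\<And>k. (\<And>j. j < k \<Longrightarrow> P j) \<Longrightarrow> P k"
  shows "P k"
proof (induction k rule: measure_induct_rule[where f = "\<lambda>k. card {..<k}"])
  case (less k)
  show ?case
  proof (rule assms)
    fix j assume "j < k"
    then have "{..<j} \<subset> {..<k}" by auto
    then show "P j" by (intro less.IH psubset_card_mono) auto
  qed
qed

text \<open>The span of the rows with index below \<open>k\<close>, written as an image so that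
  membership directly provides a coefficient vector vanishing from \<open>k\<close> on.\<close>

definition lower_rows :: "real ^ 'n ^ 'm::{finite,linorder} \<Rightarrow> 'm \<Rightarrow> (real ^ 'n) set" where
  "lower_rows B k = (\<lambda>u. transpose B *v u) ` {u. \<forall>j\<ge>k. u $ j = 0}"

text \<open>The unnormalised Gram-Schmidt vector of row \<open>k\<close>; its squared norm will be
  the pivot.\<close>

definition row_residual :: "real ^ 'n ^ 'm::{finite,linorder} \<Rightarrow> 'm \<Rightarrow> real ^ 'n" where
  "row_residual B k = B $ k - closest_point (lower_rows B k) (B $ k)"

lemma subspace_lower_rows: "subspace (lower_rows B k)"
  unfolding lower_rows_def
  by (intro linear_subspace_image) (auto simp: subspace_def matrix_vector_mul_linear)

lemma lower_rows_mono: "j \<le> k \<Longrightarrow> lower_rows B j \<subseteq> lower_rows B k"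
  unfolding lower_rows_def by (intro image_mono) auto

lemma transpose_mult_axis: "transpose B *v axis j 1 = B $ j"
  for B :: "real ^ 'n ^ 'm"
  unfolding matrix_vector_mult_basis column_transpose by (simp add: row_def)

lemma row_in_lower_rows:
  assumes "j < k"
  shows "B $ j \<in> lower_rows B k"
  unfolding lower_rows_def
proof (rule image_eqI)
  show "B $ j = transpose B *v axis j 1" by (simp only: transpose_mult_axis)
qed (use assms in \<open>auto simp: axis_def\<close>)

lemma row_residual_orthogonal: "v \<in> lower_rows B k \<Longrightarrow> inner (row_residual B k) v = 0"
  unfolding row_residual_def by (rule closest_point_subspace(2)[OF subspace_lower_rows])

lemma row_residual_in_lower_rows: "j < k \<Longrightarrow> row_residual B j \<in> lower_rows B k"
  unfolding row_residual_def
  by (intro subspace_diff subspace_lower_rows row_in_lower_rows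
      subsetD[OF lower_rows_mono closest_point_subspace(1)[OF subspace_lower_rows]]) auto

lemma row_residual_pairwise_orthogonal:
  "i \<noteq> j \<Longrightarrow> inner (row_residual B i) (row_residual B j) = 0"
  by (metis inner_commute linorder_neq_iff row_residual_in_lower_rows row_residual_orthogonal)

lemma row_in_span_row_residual: "B $ k \<in> span (row_residual B ` {..k})"
proof (induction k rule: finite_linorder_induct)
  case (1 k)
  obtain u where u: "closest_point (lower_rows B k) (B $ k) = transpose B *v u" "\<And>j. j \<ge> k \<Longrightarrow> u $ j = 0"
    using closest_point_subspace(1)[OF subspace_lower_rows[of B k], of "B $ k"]
    unfolding lower_rows_def by auto
  have "u $ j *\<^sub>R B $ j \<in> span (row_residual B ` {..k})" for j
  proof (cases "j < k")
    case True
    then have "span (row_residual B ` {..j}) \<subseteq> span (row_residual B ` {..k})"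
      by (intro span_mono image_mono) auto
    with 1[OF True] show ?thesis by (intro span_scale) auto
  next
    case False
    with u(2)[of j] show ?thesis by (simp add: span_zero)
  qed
  then have "closest_point (lower_rows B k) (B $ k) \<in> span (row_residual B ` {..k})"
    unfolding u(1) transpose_mult_eq_sum by (rule span_sum)
  moreover have "row_residual B k \<in> span (row_residual B ` {..k})"
    by (intro span_base) auto
  ultimately have "row_residual B k + closest_point (lower_rows B k) (B $ k) \<in> span (row_residual B ` {..k})"
    by (intro span_add)
  then show ?case by (simp add: row_residual_def)
qed

lemma mult_Diag_component: "(A ** Diag d) $ i $ k = A $ i $ k * d $ k"
  by (simp add: matrix_matrix_mult_def Diag_def if_distrib[where f="\<lambda>x. _ * x"] cong: if_cong)

text \<open>Expanding the rows in their residuals writes \<open>B\<close> as \<open>L\<close> times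
  the matrix of residuals, whose rows are orthogonal; the Gram matrix of the residuals is therefore
  \<open>Diag d\<close>. A zero residual makes its coefficients irrelevant, so rank deficiency
  causes no trouble.\<close>

lemma gram_schmidt_ldl:
  fixes B :: "real ^ 'n ^ 'm::{finite,linorder}"
  shows "\<exists>L. is_ldl (B ** transpose B) L (\<chi> k. (norm (row_residual B k))\<^sup>2)"
proof -
  let ?q = "row_residual B"
  define d where "d = (\<chi> k. (norm (?q k))\<^sup>2)"
  define L where "L = (\<chi> i k. if k = i then 1 else if k < i then inner (B $ i) (?q k) / (norm (?q k))\<^sup>2 else 0)"
  have self: "inner (B $ i) (?q i) = (norm (?q i))\<^sup>2" for i
  proof -
    have "inner (?q i) (closest_point (lower_rows B i) (B $ i)) = 0"
      by (intro row_residual_orthogonal closest_point_subspace(1) subspace_lower_rows)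
    then show ?thesis
      by (simp add: row_residual_def power2_norm_eq_inner inner_diff_right inner_diff_left inner_commute)
  qed
  have row: "B $ i = (\<Sum>k\<in>UNIV. L $ i $ k *\<^sub>R ?q k)" for i
  proof -
    have "B $ i = (\<Sum>k\<in>{..i}. (inner (B $ i) (?q k) / (norm (?q k))\<^sup>2) *\<^sub>R ?q k)"
      by (rule orthogonal_expansion[OF _ row_residual_pairwise_orthogonal row_in_span_row_residual]) auto
    also have "\<dots> = (\<Sum>k\<in>{..i}. L $ i $ k *\<^sub>R ?q k)"
      by (rule sum.cong) (auto simp: self L_def)
    also have "\<dots> = (\<Sum>k\<in>UNIV. L $ i $ k *\<^sub>R ?q k)"
      by (rule sum.mono_neutral_left) (auto simp: L_def)
    finally show ?thesis .
  qed
  have inner_row: "inner (?q k) (B $ j) = L $ j $ k * d $ k" for j k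
  proof -
    have "inner (?q k) (B $ j) = (\<Sum>l\<in>UNIV. L $ j $ l * inner (?q k) (?q l))"
      by (subst row) (simp add: inner_sum_right)
    also have "\<dots> = (\<Sum>l\<in>UNIV. if l = k then L $ j $ k * d $ k else 0)"
      by (rule sum.cong) (auto simp: row_residual_pairwise_orthogonal power2_norm_eq_inner d_def)
    finally show ?thesis by simp
  qed
  have "(B ** transpose B) $ i $ j = (L ** Diag d ** transpose L) $ i $ j" for i j
  proof -
    have "(B ** transpose B) $ i $ j = inner (B $ i) (B $ j)"
      by (simp add: matrix_matrix_mult_def transpose_def inner_vec_def)
    also have "\<dots> = (\<Sum>k\<in>UNIV. L $ i $ k * inner (?q k) (B $ j))"
      by (subst row) (simp add: inner_sum_left)
    also have "\<dots> = (L ** Diag d ** transpose L) $ i $ j"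
      unfolding inner_row matrix_matrix_mult_def[of "L ** Diag d"]
      by (simp add: mult_Diag_component transpose_def mult_ac)
    finally show ?thesis .
  qed
  then have "is_ldl (B ** transpose B) L d"
    by (auto simp: is_ldl_def vec_eq_iff less_eq_vec_def L_def d_def)
  then show ?thesis unfolding d_def ..
qed

lemma Diag_square: "A ** Diag (y * y) ** transpose A = (A ** Diag y) ** transpose (A ** Diag y)"
proof -
  have "transpose (Diag y) = Diag y"
    by (auto simp: vec_eq_iff Diag_def transpose_def)
  moreover have "Diag y ** Diag y = Diag (y * y)"
    by (simp add: vec_eq_iff Diag_def matrix_matrix_mult_def if_distrib[where f="\<lambda>x. _ * x"] cong: if_cong)
  ultimately show ?thesis
    by (metis matrix_transpose_mul matrix_mul_assoc)
qed

text \<open>Regularity bounds the nonzero pivots of every decomposition, in particular of the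
  Gram-Schmidt one, and so becomes a distance bound.\<close>

lemma regular_row_residual:
  assumes "\<not> sigma_singular \<sigma> A y" and "row_residual (A ** Diag y) k \<noteq> 0"
  shows "\<sigma> \<le> (norm (row_residual (A ** Diag y) k))\<^sup>2"
proof -
  let ?d = "(\<chi> k. (norm (row_residual (A ** Diag y) k))\<^sup>2)"
  obtain L where L: "is_ldl (A ** Diag (y * y) ** transpose A) L ?d"
    using gram_schmidt_ldl[of "A ** Diag y"] unfolding Diag_square ..
  define N where "N = {?d $ i | i. ?d $ i \<noteq> 0}"
  have mem: "?d $ k \<in> N"
    using assms(2) by (auto simp: N_def)
  have "\<not> (N \<noteq> {} \<and> Min N < \<sigma>)"
    using assms(1) L unfolding sigma_singular_def Let_def N_def by blast
  with mem have "\<sigma> \<le> Min N" by auto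
  also have "finite N"
    unfolding N_def by (rule finite_subset[of _ "range (($) ?d)"]) auto
  then have "Min N \<le> ?d $ k" using mem by (rule Min_le)
  finally show ?thesis by simp
qed

text \<open>Whether the first alternative holds depends on the stratum of \<open>y\<close> only; the second one is
  stable under limits.\<close>

lemma regular_alternative:
  assumes "\<not> sigma_singular \<sigma> A y"
  shows "(\<exists>w. w $ k = 1 \<and> (\<forall>j>k. w $ j = 0) \<and> transpose (A ** Diag y) *v w = 0) \<or>
    (\<forall>u. (\<forall>j>k. u $ j = 0) \<longrightarrow> \<sigma> * (u $ k)\<^sup>2 \<le> (norm (transpose (A ** Diag y) *v u))\<^sup>2)"
proof (cases "row_residual (A ** Diag y) k = 0")
  case True
  let ?B = "A ** Diag y"
  have "?B $ k \<in> lower_rows ?B k"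
    using True closest_point_subspace(1)[OF subspace_lower_rows, of ?B k "?B $ k"]
    by (simp add: row_residual_def)
  then obtain u where u: "?B $ k = transpose ?B *v u" "\<And>j. j \<ge> k \<Longrightarrow> u $ j = 0"
    unfolding lower_rows_def by blast
  have "transpose ?B *v (axis k 1 - u) = 0"
    unfolding matrix_vector_mult_diff_distrib transpose_mult_axis using u(1) by simp
  then show ?thesis
    using u(2) by (intro disjI1 exI[of _ "axis k 1 - u"]) (auto simp: axis_def)
next
  case False
  let ?B = "A ** Diag y"
  have "\<sigma> * (u $ k)\<^sup>2 \<le> (norm (transpose ?B *v u))\<^sup>2" if u: "\<forall>j>k. u $ j = 0" for u
  proof (cases "u $ k = 0")
    case uk: False
    \<comment> \<open>Scaling \<open>u\<close> to have entry 1 at \<open>k\<close> turns its image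
      into row \<open>k\<close> minus a combination of earlier rows, whose norm is at least that of
      the residual.\<close>
    define v where "v = axis k 1 - (1 / u $ k) *\<^sub>R u"
    have "v $ j = 0" if "j \<ge> k" for j
      using u uk that by (cases "j = k") (auto simp: v_def axis_def)
    then have "transpose ?B *v v \<in> lower_rows ?B k"
      unfolding lower_rows_def by blast
    then have "norm (row_residual ?B k) \<le> norm (?B $ k - transpose ?B *v v)"
      using closest_point_le[OF closed_subspace[OF subspace_lower_rows]]
      unfolding row_residual_def by (metis dist_norm)
    also have "?B $ k - transpose ?B *v v = (1 / u $ k) *\<^sub>R (transpose ?B *v u)"
      unfolding v_def matrix_vector_mult_diff_distrib transpose_mult_axis matrix_vector_mult_scaleR by simp
    finally have "(norm (row_residual ?B k))\<^sup>2 \<le> (norm (transpose ?B *v u))\<^sup>2 / (u $ k)\<^sup>2"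
      using power_mono[of "norm (row_residual ?B k)" _ 2] by (fastforce simp: power_divide)
    with regular_row_residual[OF assms False] have "\<sigma> \<le> (norm (transpose ?B *v u))\<^sup>2 / (u $ k)\<^sup>2"
      by (rule order_trans)
    with uk show ?thesis by (simp add: pos_le_divide_eq)
  qed simp
  then show ?thesis by blast
qed

text \<open>The kernel of the transpose is the orthogonal complement of the range, so it depends
  only on the stratum.\<close>

lemma transpose_mult_eq_0_iff:
  "transpose B *v u = 0 \<longleftrightarrow> (\<forall>v\<in>range ((*v) B). inner v u = 0)" for B :: "real ^ 'n ^ 'm"
proof -
  have "transpose B *v u = 0 \<longleftrightarrow> (\<forall>w. inner w (transpose B *v u) = 0)"
    by (metis inner_eq_zero_iff inner_zero_right)
  then show ?thesis unfolding inner_transpose_mult by blast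
qed

lemma transpose_Diag_mult: "transpose (A ** Diag y) *v u = y * (transpose A *v u)"
  by (rule vector_eq_ldot[THEN iffD1])
    (simp add: inner_transpose_mult mult_Diag_vector inner_mult_vec[symmetric] mult.commute
      del: transpose_matrix_vector)

text \<open>Ranges can only shrink in a limit, since \<open>V\<close> is closed. Equality amounts to
  every kernel vector of the limit transpose being orthogonal to \<open>V\<close>, which is proved
  by eliminating its last nonzero entry.\<close>

lemma regular_limit_range:
  fixes A :: "real ^ 'n ^ 'm::{finite,linorder}"
  assumes lim: "Y \<longlonglongrightarrow> ys" and reg: "\<And>i. \<not> sigma_singular \<sigma> A (Y i)" and "\<sigma> > 0"
    and V: "\<And>i. range ((*v) (A ** Diag (Y i))) = V"
  shows "range ((*v) (A ** Diag ys)) = V"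
proof
  let ?Bs = "A ** Diag ys"
  have "subspace V" using subspace_range_matrix V by metis
  show sub: "range ((*v) ?Bs) \<subseteq> V"
  proof safe
    fix w
    have lim_w: "(\<lambda>i. A *v (Y i * w)) \<longlonglongrightarrow> A *v (ys * w)"
      by (intro bounded_linear.tendsto[OF matrix_vector_mul_bounded_linear] tendsto_intros lim)
    have in_V: "A *v (Y i * w) \<in> V" for i
      using V[of i] mult_Diag_vector[of A "Y i" w] by (metis rangeI)
    show "?Bs *v w \<in> V"
      unfolding mult_Diag_vector
      by (rule closed_sequentially[OF closed_subspace[OF \<open>subspace V\<close>] in_V lim_w])
  qed
  have perp: "transpose (A ** Diag (Y i)) *v u = 0 \<longleftrightarrow> (\<forall>v\<in>V. inner v u = 0)" for i u
    unfolding transpose_mult_eq_0_iff V ..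
  have key: "\<forall>v\<in>V. inner v u = 0" if "transpose ?Bs *v u = 0" for u
    using that
  \<comment> \<open>The measured set is the initial segment of indices up to the last nonzero entry
    of \<open>u\<close>.\<close>
  proof (induction u rule: measure_induct_rule[where f = "\<lambda>u. card {j. \<exists>i\<ge>j. u $ i \<noteq> 0}"])
    case (less u)
    show ?case
    proof (cases "u = 0")
      case False
      then have ne: "{i. u $ i \<noteq> 0} \<noteq> {}" by (auto simp: vec_eq_iff)
      define k where "k = Max {i. u $ i \<noteq> 0}"
      have uk: "u $ k \<noteq> 0"
        using Max_in[OF _ ne] by (simp add: k_def)
      have u_gt: "u $ j = 0" if "j > k" for j
        using Max_ge[of "{i. u $ i \<noteq> 0}" j] that by (fastforce simp: k_def)
      show ?thesis
      proof (cases "\<exists>w. w $ k = 1 \<and> (\<forall>j>k. w $ j = 0) \<and> (\<forall>v\<in>V. inner v w = 0)")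
        case True
        then obtain w where w: "w $ k = 1" "\<And>j. j > k \<Longrightarrow> w $ j = 0" "\<forall>v\<in>V. inner v w = 0"
          by blast
        define u' where "u' = u - u $ k *\<^sub>R w"
        have "transpose ?Bs *v w = 0"
          using w(3) sub unfolding transpose_mult_eq_0_iff by blast
        then have "transpose ?Bs *v u' = 0"
          unfolding u'_def matrix_vector_mult_diff_distrib matrix_vector_mult_scaleR less.prems by simp
        moreover have "{j. \<exists>i\<ge>j. u' $ i \<noteq> 0} \<subset> {j. \<exists>i\<ge>j. u $ i \<noteq> 0}"
        proof -
          have "u' $ i = 0" if "i \<ge> k" for i
            using w(1,2) u_gt that by (cases "i = k") (auto simp: u'_def)
          then have "{j. \<exists>i\<ge>j. u' $ i \<noteq> 0} \<subseteq> {..<k}"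
            by (auto simp: not_le[symmetric] dest: order_trans)
          also have "{..<k} \<subset> {..k}"
            by (rule psubsetI) (auto dest: equalityD2)
          also have "{..k} \<subseteq> {j. \<exists>i\<ge>j. u $ i \<noteq> 0}"
            using uk by auto
          finally show ?thesis .
        qed
        ultimately have "\<forall>v\<in>V. inner v u' = 0"
          by (intro less.IH psubset_card_mono) auto
        with w(3) show ?thesis by (simp add: u'_def inner_diff_right)
      next
        case False
        \<comment> \<open>All \<open>Y i\<close> share the complement of \<open>V\<close> as kernel,
          so the first alternative fails for every \<open>i\<close> at once. The inequality then
          holds along the whole sequence and contradicts \<open>u\<close> being in the limit
          kernel.\<close>
        then have le: "\<sigma> * (u $ k)\<^sup>2 \<le> (norm (Y i * (transpose A *v u)))\<^sup>2" for i
          using regular_alternative[OF reg, of k i] u_gt unfolding perp unfolding transpose_Diag_mult by blast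
        have "(\<lambda>i. (norm (Y i * (transpose A *v u)))\<^sup>2) \<longlonglongrightarrow> (norm (ys * (transpose A *v u)))\<^sup>2"
          by (intro tendsto_intros lim)
        then have "\<sigma> * (u $ k)\<^sup>2 \<le> (norm (ys * (transpose A *v u)))\<^sup>2"
          by (rule LIMSEQ_le_const) (use le in blast)
        then show ?thesis
          using less.prems uk \<open>\<sigma> > 0\<close> unfolding transpose_Diag_mult by (simp add: mult_le_0_iff)
      qed
    qed simp
  qed
  show "V \<subseteq> range ((*v) ?Bs)"
  proof
    fix v assume "v \<in> V"
    let ?c = "closest_point (range ((*v) ?Bs)) v"
    note c = closest_point_subspace[OF subspace_range_matrix[of ?Bs], where a = v]
    \<comment> \<open>The part of \<open>v\<close> orthogonal to the limit range lies in
      \<open>V\<close> and is orthogonal to \<open>V\<close>, hence is 0.\<close>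
    have "transpose ?Bs *v (v - ?c) = 0"
      unfolding transpose_mult_eq_0_iff using c(2) by (simp add: inner_commute)
    moreover have "v - ?c \<in> V"
      using \<open>v \<in> V\<close> c(1) sub \<open>subspace V\<close> by (blast intro: subspace_diff)
    ultimately have "inner (v - ?c) (v - ?c) = 0"
      using key by blast
    then show "v \<in> range ((*v) ?Bs)" using c(1) by simp
  qed
qed

section \<open>Convergence\<close>

text \<open>Projection onto a subspace leaves an orthogonal remainder. The second identity gives the
  slope of a gradient step and survives limits of the gradients.\<close>

lemma riemannian_grad:
  fixes A :: "real ^ 'n ^ 'm"
  assumes "z \<in> lifted_set A b"
  shows "riemannian_grad \<phi> A b z \<in> stratum_tangent A z"
    and "inner (gradient (lifted_objective \<phi>) z) (riemannian_grad \<phi> A b z) = (norm (riemannian_grad \<phi> A b z))\<^sup>2"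
    and "norm (riemannian_grad \<phi> A b z) \<le> norm (gradient (lifted_objective \<phi>) z)"
proof -
  let ?g = "riemannian_grad \<phi> A b z" and ?G = "gradient (lifted_objective \<phi>) z"
  have g: "?g = closest_point (stratum_tangent A z) ?G"
    by (simp add: riemannian_grad_def tangent_space_stratum[OF assms])
  show in_T: "?g \<in> stratum_tangent A z"
    unfolding g by (rule closest_point_subspace(1)[OF subspace_stratum_tangent])
  have "inner (?G - ?g) ?g = 0"
    using closest_point_subspace(2)[OF subspace_stratum_tangent in_T] by (simp add: g)
  then show eq: "inner ?G ?g = (norm ?g)\<^sup>2"
    by (simp add: inner_diff_left power2_norm_eq_inner)
  have "norm ?g * norm ?g \<le> norm ?G * norm ?g"
    using norm_cauchy_schwarz[of ?G ?g] eq by (simp add: power2_eq_square)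
  then show "norm ?g \<le> norm ?G"
    by (cases "?g = 0") auto
qed

text \<open>The vector \<open>g\<close> is left free: it is the gradient at \<open>z\<close> when a
  single step is studied, and a limit of gradients from nearby points in the convergence
  argument.\<close>

lemma retr_stepsize_decrease_local:
  fixes A :: "real ^ 'n ^ 'm"
  assumes \<phi>: "continuously_differentiable \<phi>" and z: "z \<in> lifted_set A b"
    and R: "manifold_retraction (stratum A b z) (Retr (stratum A b z))"
    and g: "g \<in> stratum_tangent A z" "g \<noteq> 0"
      "inner (gradient (lifted_objective \<phi>) z) g = (norm g)\<^sup>2" and \<delta>: "0 < \<delta>" "\<delta> < 1"
  obtains r c where "r > 0" "c > 0"
    "\<And>y. y \<in> stratum A b z \<Longrightarrow> dist y z < r \<Longrightarrow> dist (riemannian_grad \<phi> A b y) g < r \<Longrightarrow>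
       lifted_objective \<phi> (retr_step Retr \<phi> A b (retr_stepsize Retr \<phi> A b \<delta> y) y)
         \<le> lifted_objective \<phi> y - c * (norm (riemannian_grad \<phi> A b y))\<^sup>2"
proof -
  let ?f = "lifted_objective \<phi>"
  obtain r \<tau> where r: "r > 0" "\<tau> > 0" and arm:
    "\<And>y u t. y \<in> stratum A b z \<Longrightarrow> u \<in> stratum_tangent A y \<Longrightarrow> dist y z < r \<Longrightarrow> dist u g < r \<Longrightarrow>
       0 < t \<Longrightarrow> t \<le> \<tau> \<Longrightarrow>
       ?f (Retr (stratum A b z) (y, - t *\<^sub>R u)) \<le> ?f y - t * \<delta> * (norm u)\<^sup>2"
    using retr_armijo_local[OF \<phi> z R g \<delta>(2)] by metis
  obtain n where n: "n \<ge> 1" "(1/2) ^ n \<le> \<tau>"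
    using half_power_le[OF \<open>\<tau> > 0\<close>] .
  show thesis
  proof (rule that[of r "(1/2) ^ n * \<delta>"])
    fix y assume y: "y \<in> stratum A b z" "dist y z < r" and u: "dist (riemannian_grad \<phi> A b y) g < r"
    let ?u = "riemannian_grad \<phi> A b y"
    let ?P = "\<lambda>j. ?f (retr_step Retr \<phi> A b ((1/2) ^ j) y) \<le> ?f y - (1/2) ^ j * \<delta> * (norm ?u)\<^sup>2"
    define j where "j = (LEAST j. ?P j)"
    have "?u \<in> stratum_tangent A y"
      using y(1) stratum_subset_lifted_set by (intro riemannian_grad) auto
    then have "?P n"
      unfolding retr_step_def stratum_eq[OF y(1)]
      by (intro arm y u n(2)) auto
    then have j: "?P j" "j \<le> n"
      unfolding j_def by (rule LeastI, rule Least_le)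
    have "(1/2) ^ n * \<delta> * (norm ?u)\<^sup>2 \<le> (1/2) ^ j * \<delta> * (norm ?u)\<^sup>2"
      using \<delta> j(2) by (intro mult_right_mono power_decreasing) auto
    then show "?f (retr_step Retr \<phi> A b (retr_stepsize Retr \<phi> A b \<delta> y) y)
        \<le> ?f y - (1/2) ^ n * \<delta> * (norm ?u)\<^sup>2"
      using j(1) unfolding retr_stepsize_def j_def[symmetric] by linarith
  qed (use r \<delta> in auto)
qed

lemma retr_stepsize_nonincreasing:
  fixes A :: "real ^ 'n ^ 'm"
  assumes \<phi>: "continuously_differentiable \<phi>" and z: "z \<in> lifted_set A b"
    and R: "manifold_retraction (stratum A b z) (Retr (stratum A b z))"
    and "riemannian_grad \<phi> A b z \<noteq> 0" and \<delta>: "0 < \<delta>" "\<delta> < 1"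
  shows "lifted_objective \<phi> (retr_step Retr \<phi> A b (retr_stepsize Retr \<phi> A b \<delta> z) z) \<le> lifted_objective \<phi> z"
proof -
  obtain r c where rc: "r > 0" "c > 0"
    "\<And>y. y \<in> stratum A b z \<Longrightarrow> dist y z < r \<Longrightarrow> dist (riemannian_grad \<phi> A b y) (riemannian_grad \<phi> A b z) < r \<Longrightarrow>
       lifted_objective \<phi> (retr_step Retr \<phi> A b (retr_stepsize Retr \<phi> A b \<delta> y) y)
         \<le> lifted_objective \<phi> y - c * (norm (riemannian_grad \<phi> A b y))\<^sup>2"
    using retr_stepsize_decrease_local[where \<phi> = \<phi> and Retr = Retr,
        OF \<phi> z R riemannian_grad(1)[OF z] assms(4) riemannian_grad(2)[OF z] \<delta>]
    by metis
  have "0 \<le> c * (norm (riemannian_grad \<phi> A b z))\<^sup>2" using rc(2) by simp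
  with rc(3)[OF stratum_self[OF z]] rc(1) show ?thesis by fastforce
qed

lemma retr_step_lifted:
  fixes A :: "real ^ 'n ^ 'm"
  assumes z: "z \<in> lifted_set A b"
    and R: "manifold_retraction (stratum A b z) (Retr (stratum A b z))"
  shows "retr_step Retr \<phi> A b t z \<in> lifted_set A b"
proof -
  have "(z, - t *\<^sub>R riemannian_grad \<phi> A b z) \<in> tangent_bundle (stratum A b z)"
    unfolding tangent_bundle_stratum
    using z by (intro conjI stratum_self subspace_scale[OF subspace_stratum_tangent] riemannian_grad)
  then show ?thesis
    using R stratum_subset_lifted_set[of A b z] unfolding retr_step_def manifold_retraction_def by blast
qed

lemma square_in_feasible_set: "y \<in> lifted_set A b \<Longrightarrow> y * y \<in> feasible_set A b"
  by (simp add: lifted_set_def feasible_set_def less_eq_vec_def)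

lemma vec_sqrt_square: "x \<in> feasible_set A b \<Longrightarrow> vec_sqrt x * vec_sqrt x = x"
  by (simp add: feasible_set_def less_eq_vec_def vec_eq_iff vec_sqrt_def)

lemma closed_lifted_set: "closed (lifted_set A b)" for A :: "real ^ 'n ^ 'm"
  unfolding lifted_set_def
  by (intro closed_Collect_eq continuous_intros
      linear_continuous_on_compose[OF _ matrix_vector_mul_linear])

text \<open>There are only finitely many supports, so some stratum recurs; it contains the limit by
  regularity. Continuity of the Riemannian gradient is not needed: boundedness gives a limit vector,
  and tangency passes to the limit.\<close>

lemma regular_subsequence:
  fixes A :: "real ^ 'n ^ 'm::{finite,linorder}"
  assumes \<phi>: "continuously_differentiable \<phi>"
    and lim: "Y \<longlonglongrightarrow> ys" and lifted: "\<And>i. Y i \<in> lifted_set A b"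
    and reg: "\<And>i. \<not> sigma_singular \<sigma> A (Y i)" and "\<sigma> > 0"
    and grad: "\<And>i. \<epsilon> < norm (riemannian_grad \<phi> A b (Y i))" and "\<epsilon> > 0"
  obtains p g where "strict_mono p" "\<And>i. Y (p i) \<in> stratum A b ys"
    "(\<lambda>i. riemannian_grad \<phi> A b (Y (p i))) \<longlonglongrightarrow> g" "g \<in> stratum_tangent A ys" "g \<noteq> 0"
    "inner (gradient (lifted_objective \<phi>) ys) g = (norm g)\<^sup>2"
proof -
  let ?G = "gradient (lifted_objective \<phi>)" and ?g = "riemannian_grad \<phi> A b"
  have ys: "ys \<in> lifted_set A b"
    using closed_sequentially[OF closed_lifted_set lifted lim] .
  obtain i0 where i0: "infinite {i. {j. Y i $ j \<noteq> 0} = {j. Y i0 $ j \<noteq> 0}}"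
    using pigeonhole_infinite[of "UNIV :: nat set" "\<lambda>i. {j. Y i $ j \<noteq> 0}"] by auto
  then obtain p where p: "strict_mono (p :: nat \<Rightarrow> nat)"
    and supp: "\<And>n. {j. Y (p n) $ j \<noteq> 0} = {j. Y i0 $ j \<noteq> 0}"
    using infinite_enumerate[OF i0] by auto
  have V: "range ((*v) (A ** Diag (Y (p n)))) = range ((*v) (A ** Diag (Y i0)))" for n
    using supp[of n] by (intro subset_antisym range_Diag_mono) blast+
  have lim_p: "(\<lambda>n. Y (p n)) \<longlonglongrightarrow> ys"
    using LIMSEQ_subseq_LIMSEQ[OF lim p] by (simp add: o_def)
  have Vs: "range ((*v) (A ** Diag ys)) = range ((*v) (A ** Diag (Y i0)))"
    by (rule regular_limit_range[OF lim_p reg \<open>\<sigma> > 0\<close> V])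
  have cont_G: "continuous_on UNIV ?G"
    using continuously_differentiable_lifted_objective[OF \<phi>] by (simp add: continuously_differentiable_def)
  have lim_G: "(\<lambda>n. ?G (Y (p n))) \<longlonglongrightarrow> ?G ys"
    using continuous_on_tendsto_compose[OF cont_G lim_p] by simp
  have "bounded (range (\<lambda>n. ?G (Y (p n))))"
    using lim_G by (intro convergent_imp_bounded)
  then obtain K where "\<And>n. norm (?G (Y (p n))) \<le> K"
    by (auto simp: bounded_iff)
  then have "norm (?g (Y (p n))) \<le> K" for n
    using riemannian_grad(3)[OF lifted] order_trans by blast
  then have "bounded (range (\<lambda>n. ?g (Y (p n))))"
    by (auto simp: bounded_iff)
  then obtain g q where q: "strict_mono (q :: nat \<Rightarrow> nat)" "((\<lambda>n. ?g (Y (p n))) \<circ> q) \<longlonglongrightarrow> g"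
    using bounded_imp_convergent_subsequence by blast
  then have lim_g: "(\<lambda>n. ?g (Y (p (q n)))) \<longlonglongrightarrow> g" by (simp add: o_def)
  have lim_pq: "(\<lambda>n. Y (p (q n))) \<longlonglongrightarrow> ys"
    using LIMSEQ_subseq_LIMSEQ[OF lim_p q(1)] by (simp add: o_def)
  have lim_Gpq: "(\<lambda>n. ?G (Y (p (q n)))) \<longlonglongrightarrow> ?G ys"
    using LIMSEQ_subseq_LIMSEQ[OF lim_G q(1)] by (simp add: o_def)
  have tan: "?g (Y i) \<in> stratum_tangent A (Y i)" for i
    using riemannian_grad(1)[OF lifted] .
  show thesis
  proof (rule that[of "p \<circ> q" g])
    show "strict_mono (p \<circ> q)" using p q(1) by (rule strict_mono_o)
    show "Y ((p \<circ> q) i) \<in> stratum A b ys" for i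
      using lifted V Vs by (simp add: stratum_def)
    show "(\<lambda>i. ?g (Y ((p \<circ> q) i))) \<longlonglongrightarrow> g" using lim_g by simp
    have "(\<lambda>n. A *v (Y (p (q n)) * ?g (Y (p (q n))))) \<longlonglongrightarrow> A *v (ys * g)"
      by (intro bounded_linear.tendsto[OF matrix_vector_mul_bounded_linear] tendsto_intros lim_pq lim_g)
    moreover have "A *v (Y i * ?g (Y i)) = 0" for i
      using tan by (simp add: stratum_tangent_def)
    ultimately have "A *v (ys * g) = 0"
      by (simp add: LIMSEQ_const_iff)
    moreover have "g $ j = 0" if "column j A \<notin> range ((*v) (A ** Diag ys))" for j
    proof -
      have "?g (Y (p (q n))) $ j = 0" for n
        using tan[of "p (q n)"] that V Vs by (simp add: stratum_tangent_def)
      with tendsto_vec_nth[OF lim_g, of j] show ?thesis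
        by (simp add: LIMSEQ_const_iff)
    qed
    ultimately show "g \<in> stratum_tangent A ys"
      by (simp add: stratum_tangent_def)
    have "\<epsilon> \<le> norm g"
      by (rule LIMSEQ_le_const[OF tendsto_norm[OF lim_g]]) (use grad less_imp_le in blast)
    then show "g \<noteq> 0" using \<open>\<epsilon> > 0\<close> by auto
    have "(\<lambda>n. inner (?G (Y (p (q n)))) (?g (Y (p (q n))))) \<longlonglongrightarrow> inner (?G ys) g"
      by (intro tendsto_intros lim_Gpq lim_g)
    moreover have "(\<lambda>n. inner (?G (Y (p (q n)))) (?g (Y (p (q n))))) \<longlonglongrightarrow> (norm g)\<^sup>2"
      unfolding riemannian_grad(2)[OF lifted] by (intro tendsto_intros lim_g)
    ultimately show "inner (?G ys) g = (norm g)\<^sup>2"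
      by (rule LIMSEQ_unique)
  qed
qed

text \<open>The stratum of the limit is reached along a further subsequence only, so the decrease
  holds frequently; that suffices against a property that holds eventually.\<close>

lemma riemannian_steps_decrease:
  fixes A :: "real ^ 'n ^ 'm::{finite,linorder}"
  assumes \<phi>: "continuously_differentiable \<phi>"
    and lim: "Y \<longlonglongrightarrow> ys" and lifted: "\<And>i. Y i \<in> lifted_set A b"
    and reg: "\<And>i. \<not> sigma_singular \<sigma> A (Y i)" and \<sigma>: "\<sigma> > 0"
    and grad: "\<And>i. \<epsilon> < norm (riemannian_grad \<phi> A b (Y i))" and \<epsilon>: "\<epsilon> > 0"
    and R: "manifold_retraction (stratum A b ys) (Retr (stratum A b ys))"
    and \<delta>: "0 < \<delta>" "\<delta> < 1"
  obtains \<eta> where "\<eta> > 0"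
    "\<exists>\<^sub>F i in sequentially. lifted_objective \<phi> (retr_step Retr \<phi> A b (retr_stepsize Retr \<phi> A b \<delta> (Y i)) (Y i))
       \<le> lifted_objective \<phi> (Y i) - \<eta>"
proof -
  let ?f = "lifted_objective \<phi>" and ?g = "riemannian_grad \<phi> A b"
  let ?next = "\<lambda>z. retr_step Retr \<phi> A b (retr_stepsize Retr \<phi> A b \<delta> z) z"
  have ys: "ys \<in> lifted_set A b"
    using closed_sequentially[OF closed_lifted_set lifted lim] .
  obtain p g where p: "strict_mono p" and strat: "\<And>i. Y (p i) \<in> stratum A b ys"
    and lim_g: "(\<lambda>i. ?g (Y (p i))) \<longlonglongrightarrow> g"
    and g: "g \<in> stratum_tangent A ys" "g \<noteq> 0" "inner (gradient ?f ys) g = (norm g)\<^sup>2"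
    using regular_subsequence[OF \<phi> lim lifted reg \<sigma> grad \<epsilon>] by blast
  obtain \<rho> c where \<rho>: "\<rho> > 0" "c > 0"
    and decr: "\<And>z. z \<in> stratum A b ys \<Longrightarrow> dist z ys < \<rho> \<Longrightarrow> dist (?g z) g < \<rho> \<Longrightarrow>
      ?f (?next z) \<le> ?f z - c * (norm (?g z))\<^sup>2"
    using retr_stepsize_decrease_local[where Retr = Retr, OF \<phi> ys R g \<delta>] by metis
  show thesis
  proof (rule that)
    show "c * \<epsilon>\<^sup>2 > 0" using \<rho>(2) \<epsilon> by simp
    have "(\<lambda>i. Y (p i)) \<longlonglongrightarrow> ys"
      using LIMSEQ_subseq_LIMSEQ[OF lim p] by (simp add: o_def)
    from tendstoD[OF this \<rho>(1)] tendstoD[OF lim_g \<rho>(1)]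
    have ev: "eventually (\<lambda>i. ?f (?next (Y (p i))) \<le> ?f (Y (p i)) - c * \<epsilon>\<^sup>2) sequentially"
    proof eventually_elim
      case (elim i)
      have "\<epsilon>\<^sup>2 \<le> (norm (?g (Y (p i))))\<^sup>2"
        using \<epsilon> grad by (intro power_mono less_imp_le) auto
      then have "c * \<epsilon>\<^sup>2 \<le> c * (norm (?g (Y (p i))))\<^sup>2"
        using \<rho>(2) by simp
      with decr[OF strat elim] show ?case by linarith
    qed
    show "\<exists>\<^sub>F i in sequentially. ?f (?next (Y i)) \<le> ?f (Y i) - c * \<epsilon>\<^sup>2"
      unfolding frequently_def
    proof
      assume "eventually (\<lambda>i. \<not> ?f (?next (Y i)) \<le> ?f (Y i) - c * \<epsilon>\<^sup>2) sequentially"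
      from eventually_compose_filterlim[OF this filterlim_subseq[OF p]] ev
      have "eventually (\<lambda>i. False) sequentially"
        by eventually_elim simp
      then show False by simp
    qed
  qed
qed

section \<open>Invariants of a run and the final argument\<close>

definition riemannian_step ::
  "(real ^ 'n \<Rightarrow> real) \<Rightarrow> real ^ 'n ^ ('m::{finite,linorder}) \<Rightarrow> real ^ ('m::{finite,linorder}) \<Rightarrow> real \<Rightarrow> real \<Rightarrow> real ^ 'n \<Rightarrow> bool" where
  "riemannian_step \<phi> A b \<sigma> \<epsilon> z \<longleftrightarrow> \<not> sigma_singular \<sigma> A z \<and> norm (riemannian_grad \<phi> A b z) > \<epsilon>"

lemma hybrid_run_riemannian_step:
  assumes "hybrid_run \<phi> A b Retr \<delta> \<sigma> \<epsilon> x y" "riemannian_step \<phi> A b \<sigma> \<epsilon> (y k)"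
  shows "y (Suc k) = retr_step Retr \<phi> A b (retr_stepsize Retr \<phi> A b \<delta> (y k)) (y k)"
    and "x (Suc k) = y (Suc k) * y (Suc k)"
  using assms unfolding hybrid_run_def riemannian_step_def by metis+

lemma hybrid_run_projection_step:
  assumes "hybrid_run \<phi> A b Retr \<delta> \<sigma> \<epsilon> x y" "\<not> riemannian_step \<phi> A b \<sigma> \<epsilon> (y k)"
  shows "x (Suc k) = proj_step \<phi> A b (proj_stepsize \<phi> A b \<delta> (x k)) (x k)"
    and "y (Suc k) = vec_sqrt (x (Suc k))"
  using assms unfolding hybrid_run_def riemannian_step_def by metis+

lemma hybrid_run_lifted:
  assumes run: "hybrid_run \<phi> A b Retr \<delta> \<sigma> \<epsilon> x y" and y0: "y 0 \<in> lifted_set A b"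
    and R: "\<And>z. z \<in> lifted_set A b \<Longrightarrow> manifold_retraction (stratum A b z) (Retr (stratum A b z))"
  shows "y k \<in> lifted_set A b \<and> x k = y k * y k"
proof (induction k)
  case 0
  then show ?case using y0 run unfolding hybrid_run_def by blast
next
  case (Suc k)
  show ?case
  proof (cases "riemannian_step \<phi> A b \<sigma> \<epsilon> (y k)")
    case True
    have "y (Suc k) \<in> lifted_set A b"
      unfolding hybrid_run_riemannian_step(1)[OF run True]
      using Suc R by (intro retr_step_lifted) auto
    with hybrid_run_riemannian_step(2)[OF run True] show ?thesis by simp
  next
    case False
    note step = hybrid_run_projection_step[OF run False]
    have "x k \<in> feasible_set A b"
      using Suc square_in_feasible_set[of "y k" A b] by simp
    then have *: "x (Suc k) \<in> feasible_set A b"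
      unfolding step(1) by (rule proj_step_feasible)
    then have "x (Suc k) = y (Suc k) * y (Suc k)"
      unfolding step(2) by (rule vec_sqrt_square[symmetric])
    with * show ?thesis
      by (simp add: lifted_set_def feasible_set_def)
  qed
qed

lemma hybrid_run_nonincreasing:
  assumes \<phi>: "continuously_differentiable \<phi>"
    and run: "hybrid_run \<phi> A b Retr \<delta> \<sigma> \<epsilon> x y" and y0: "y 0 \<in> lifted_set A b"
    and R: "\<And>z. z \<in> lifted_set A b \<Longrightarrow> manifold_retraction (stratum A b z) (Retr (stratum A b z))"
    and \<delta>: "0 < \<delta>" "\<delta> < 1" and \<epsilon>: "0 < \<epsilon>"
  shows "decseq (\<lambda>k. \<phi> (x k))"
proof (rule decseq_SucI)
  fix k
  have inv: "y k \<in> lifted_set A b" "x k = y k * y k" for k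
    using hybrid_run_lifted[OF run y0 R] by auto
  show "\<phi> (x (Suc k)) \<le> \<phi> (x k)"
  proof (cases "riemannian_step \<phi> A b \<sigma> \<epsilon> (y k)")
    case True
    then have "riemannian_grad \<phi> A b (y k) \<noteq> 0"
      using \<epsilon> by (auto simp: riemannian_step_def)
    from retr_stepsize_nonincreasing[where Retr = Retr, OF \<phi> inv(1) R[OF inv(1)] this \<delta>]
    have "lifted_objective \<phi> (y (Suc k)) \<le> lifted_objective \<phi> (y k)"
      unfolding hybrid_run_riemannian_step(1)[OF run True] .
    then show ?thesis by (simp add: lifted_objective_def inv(2))
  next
    case False
    have "x k \<in> feasible_set A b"
      unfolding inv(2) by (rule square_in_feasible_set) (rule inv(1))
    then show ?thesis
      unfolding hybrid_run_projection_step(1)[OF run False]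
      by (rule proj_stepsize_nonincreasing[OF \<phi> _ \<delta>])
  qed
qed

text \<open>Monotonicity makes the limit of the subsequence a lower bound for the entire sequence.
  Once a value is within \<open>\<eta>\<close> of it, a drop by \<open>\<eta>\<close> would go below
  that bound.\<close>

lemma decseq_no_recurrent_decrease:
  fixes \<Phi> :: "nat \<Rightarrow> real"
  assumes "decseq \<Phi>" "strict_mono s" and lim: "(\<lambda>i. \<Phi> (s i)) \<longlonglongrightarrow> l" and "\<eta> > 0"
  shows "eventually (\<lambda>i. \<not> \<Phi> (Suc (s i)) \<le> \<Phi> (s i) - \<eta>) sequentially"
proof -
  have lower: "l \<le> \<Phi> k" for k
  proof (rule LIMSEQ_le_const2[OF lim], intro exI allI impI)
    fix i assume "k \<le> i"
    also have "i \<le> s i" using assms(2) by (rule strict_mono_imp_increasing)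
    finally show "\<Phi> (s i) \<le> \<Phi> k" using assms(1) by (simp add: decseq_def)
  qed
  have "eventually (\<lambda>i. \<Phi> (s i) < l + \<eta>) sequentially"
    using \<open>\<eta> > 0\<close> by (intro order_tendstoD(2)[OF lim]) simp
  then show ?thesis
  proof eventually_elim
    case (elim i)
    with lower[of "Suc (s i)"] show ?case by simp
  qed
qed

theorem theorem13:
  fixes \<phi> :: "real ^ 'n \<Rightarrow> real"
    and A :: "real ^ 'n ^ ('m::{finite,linorder})"
    and b :: "real ^ ('m::{finite,linorder})"
    and Retr :: "(real ^ 'n) set \<Rightarrow> (real ^ 'n) \<times> (real ^ 'n) \<Rightarrow> real ^ 'n"
    and \<delta> \<sigma> \<epsilon> :: real
    and x y :: "nat \<Rightarrow> real ^ 'n"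
    and ystar :: "real ^ 'n"
  assumes "continuously_differentiable \<phi>"
    and "rank A = CARD('m::{finite,linorder})"
    and "feasible_set A b \<noteq> {}"
    and "\<And>z. z \<in> lifted_set A b \<Longrightarrow> manifold_retraction (stratum A b z) (Retr (stratum A b z))"
    and "\<delta> \<in> {0<..<1}" and "\<sigma> \<in> {0<..<1}" and "\<epsilon> \<in> {0<..<1}"
    and "y 0 \<in> lifted_set A b"
    and "hybrid_run \<phi> A b Retr \<delta> \<sigma> \<epsilon> x y"
    and "accumulation_point (\<lambda>k. y (Suc k)) ystar"
  shows "first_order_stationary \<phi> A b (ystar * ystar)"
proof -
  note \<phi> = assms(1) and R = assms(4) and run = assms(9)
  let ?xs = "ystar * ystar"
  let ?riem = "\<lambda>k. riemannian_step \<phi> A b \<sigma> \<epsilon> (y k)"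
  have \<delta>: "0 < \<delta>" "\<delta> < 1" and \<sigma>: "0 < \<sigma>" and \<epsilon>: "0 < \<epsilon>"
    using assms(5-7) by auto
  have y: "y k \<in> lifted_set A b" and x_eq: "x k = y k * y k" for k
    using hybrid_run_lifted[OF run assms(8) R] by auto
  have x: "x k \<in> feasible_set A b" for k
    unfolding x_eq using y by (rule square_in_feasible_set)
  have f_y: "lifted_objective \<phi> (y k) = \<phi> (x k)" for k
    by (simp add: lifted_objective_def x_eq)
  obtain r where r: "strict_mono r" "((\<lambda>k. y (Suc k)) \<circ> r) \<longlonglongrightarrow> ystar"
    using assms(10) unfolding accumulation_point_def by blast
  \<comment> \<open>The accumulation point is taken of the iterates from index 1 on; the shift turns
    \<open>r\<close> into indices of \<open>y\<close> itself.\<close>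
  define s where "s i = Suc (r i)" for i
  have s: "strict_mono s"
    using r(1) by (simp add: s_def strict_mono_def)
  have lim_y: "(\<lambda>i. y (s i)) \<longlonglongrightarrow> ystar"
    using r(2) by (simp add: s_def o_def)
  have lim_x: "(\<lambda>i. x (s i)) \<longlonglongrightarrow> ?xs"
    unfolding x_eq by (intro tendsto_intros lim_y)
  have ystar: "ystar \<in> lifted_set A b"
    using closed_sequentially[OF closed_lifted_set y lim_y] .
  then have xs: "?xs \<in> feasible_set A b"
    by (rule square_in_feasible_set)
  have dec: "decseq (\<lambda>k. \<phi> (x k))"
    by (rule hybrid_run_nonincreasing[OF \<phi> run assms(8) _ \<delta> \<epsilon>]) (rule R)
  have "isCont \<phi> ?xs"
    using \<phi> by (simp add: continuously_differentiable_def differentiable_imp_continuous_within)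
  then have "(\<lambda>i. \<phi> (x (s i))) \<longlonglongrightarrow> \<phi> ?xs"
    using lim_x by (rule isCont_tendsto_compose)
  note no_decrease = decseq_no_recurrent_decrease[OF dec s this]

  have "\<not> eventually (\<lambda>i. ?riem (s i)) sequentially"
  proof
    assume "eventually (\<lambda>i. ?riem (s i)) sequentially"
    then obtain N where N: "\<And>i. ?riem (s (i + N))"
      unfolding eventually_sequentially by (metis le_add2)
    have Y: "\<not> sigma_singular \<sigma> A (y (s (i + N)))" "\<epsilon> < norm (riemannian_grad \<phi> A b (y (s (i + N))))" for i
      using N[of i] by (auto simp: riemannian_step_def)
    have lim_Y: "(\<lambda>i. y (s (i + N))) \<longlonglongrightarrow> ystar"
      using lim_y by (rule LIMSEQ_ignore_initial_segment)
    obtain \<eta> where "\<eta> > 0" and freq: "\<exists>\<^sub>F i in sequentially.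
        lifted_objective \<phi> (y (Suc (s (i + N)))) \<le> lifted_objective \<phi> (y (s (i + N))) - \<eta>"
      unfolding hybrid_run_riemannian_step(1)[OF run N]
      using riemannian_steps_decrease[where Retr = Retr and Y = "\<lambda>i. y (s (i + N))",
          OF \<phi> lim_Y y Y(1) \<sigma> Y(2) \<epsilon> R[OF ystar] \<delta>]
      by blast
    have "eventually (\<lambda>i. \<not> \<phi> (x (Suc (s (i + N)))) \<le> \<phi> (x (s (i + N))) - \<eta>) sequentially"
      using no_decrease[OF \<open>\<eta> > 0\<close>] by (rule sequentially_offset)
    with freq show False
      by (simp add: f_y frequently_def)
  qed
  \<comment> \<open>Near a point that is not fixed, a projected step would force a decrease by
    \<open>\<eta>\<close>, which \<open>no_decrease\<close> eventually excludes; only Riemannian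
    steps would remain.\<close>
  moreover have "eventually (\<lambda>i. ?riem (s i)) sequentially" if neq: "proj_step \<phi> A b 1 ?xs \<noteq> ?xs"
  proof -
    obtain \<rho> \<eta> where \<rho>: "\<rho> > 0" "\<eta> > 0" and decr: "\<And>z. z \<in> feasible_set A b \<Longrightarrow> dist z ?xs < \<rho> \<Longrightarrow>
       \<phi> (proj_step \<phi> A b (proj_stepsize \<phi> A b \<delta> z) z) \<le> \<phi> z - \<eta>"
      using proj_stepsize_decrease_local[OF \<phi> xs neq \<delta>] by metis
    show ?thesis
      using tendstoD[OF lim_x \<rho>(1)] no_decrease[OF \<rho>(2)]
    proof eventually_elim
      case (elim i)
      then show ?case
        using decr[OF x elim(1)] hybrid_run_projection_step(1)[OF run, of "s i"] by metis
    qed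
  qed
  ultimately have "proj_step \<phi> A b 1 ?xs = ?xs" by blast
  with xs show ?thesis by (rule stationary_if_proj_step_fixed)
qed

end
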